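(* Let $\Theta\subseteq\mathbb{R}^l$ be a closed convex set, let $f:\mathbb{R}^n\times\mathbb{R}^m\to\mathbb{R}^n$ and $g:\mathbb{R}^n\times\mathbb{R}^m\to\mathbb{R}^{n\times l}$ be smooth with $f(0,0)=0$, $g(0,0)=0$, and consider the control system $\dot x=f(x,u)+g(x,u)\theta$ with state $x\in\mathbb{R}^n$, input $u\in\mathbb{R}^m$ and constant unknown parameter $\theta\in\Theta$. Suppose there are a smooth mapping $k:\Theta\times\mathbb{R}^n\to\mathbb{R}^m$ with $k(\theta,0)=0$ for all $\theta\in\Theta$, a constant $\sigma>0$, and a continuous mapping $V:\Theta\times\mathbb{R}^n\to\mathbb{R}_+$ such that for each $\theta\in\Theta$ the function $V(\theta,\cdot)$ is continuously differentiable, positive definite and radially unbounded, and such that: (H1) for each $\theta\in\Theta$, $0\in\mathbb{R}^n$ is globally asymptotically stable for $\dot x=f(x,k(\theta,x))+g(x,k(\theta,x))\theta$; more specifically, $\nabla V(\theta,x)\big(f(x,k(\theta,x))+g(x,k(\theta,x))\theta\big)\le-2\sigma V(\theta,x)$ for all $\theta\in\Theta$, $x\in\mathbb{R}^n$ (gradient with respect to $x$); (H2) for every non-empty compact set $\bar\Theta\subseteq\Theta$ and every $M\ge0$ there exists $R>0$ such that $V(\theta,x)\le M$ and $\theta\in\bar\Theta$ imply $|x|\le R$. Moreover, suppose that for each $\theta\in\Theta$, $0\in\mathbb{R}^n$ is globally exponentially stable for $\dot x=f(x,k(\theta,x))+g(x,k(\theta,x))\theta$, and that for every non-empty compact set $\bar\Theta\subseteq\Theta$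 there exist constants $K_2>K_1>0$ such that $$K_1|x|^2\le V(\theta,x)\le K_2|x|^2\quad\text{for all }x\in\mathbb{R}^n,\ \theta\in\bar\Theta.$$ Let $T>0$ be a constant and let $a:\mathbb{R}^n\to\mathbb{R}_+$ be a continuous, positive definite function satisfying $\sup\{|x|^{-2}a(x):x\in\mathbb{R}^n,\ x\ne0\}<+\infty$. Then there exists a family of constants $M_{\theta,\hat\theta}>0$, parameterized by $\theta\in\Theta$, $\hat\theta\in\Theta$, such that for every $\theta\in\Theta$, $x_0\in\mathbb{R}^n$, $\hat\theta_0\in\Theta$ the solution of the hybrid closed-loop system (the plant with the event-triggered adaptive controller and batch least-squares identifier built from $k,V,a,T$ as described in the context) with $x(0)=x_0$, $\hat\theta(0)=\hat\theta_0$ satisfies $|x(t)|\le M_{\theta,\hat\theta_0}\exp(-\sigma t)|x_0|$ for all $t\ge0$, where $\sigma>0$ is the constant in (H1).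
   Context: Notation: $|\cdot|$ is the Euclidean norm, $\mathbb{R}_+=[0,\infty)$, $\mathbb{Z}_+=\{0,1,2,\dots\}$, $A'$ is the transpose of $A$. $V:\mathbb{R}^n\to\mathbb{R}_+$ is positive definite if $V(0)=0$ and $V(x)>0$ for $x\ne0$; a continuous $V:\mathbb{R}^n\to\mathbb{R}_+$ is radially unbounded if $\{x:V(x)\le M\}$ is compact for every $M>0$. Hybrid closed-loop system. Given $k,V,a,T$ and the (unknown to the controller) parameter $\theta\in\Theta$, a solution consists of a continuous function $x(t)\in\mathbb{R}^n$, a right-continuous piecewise constant function $\hat\theta(t)\in\Theta$, and event times $0=\tau_0<\tau_1<\tau_2<\dots$ such that: (1) Control between events: for $t\in[\tau_i,\tau_{i+1})$, $i\in\mathbb{Z}_+$, one has $\hat\theta(t)=\hat\theta(\tau_i)$, $u(t)=k(\hat\theta(\tau_i),x(t))$ and $\dot x(t)=f(x(t),u(t))+g(x(t),u(t))\theta$ (right derivative at $t=\tau_i$). (2) Event times: $\tau_{i+1}=\min(\tau_i+T,r_i)$, where, if $x(\tau_i)\ne0$, $$r_i=\inf\{t>\tau_i:\ V(\hat\theta(\tau_i),x(t))=V(\hat\theta(\tau_i),x(\tau_i))+a(x(\tau_i))\}$$ with $x(t)$ the solution of the plant started from $x(\tau_i)$ at time $\tau_i$ with $u(t)=k(\hat\theta(\tau_i),x(t))$ ($r_i=+\infty$ if no such $t$ exists), and $r_i=\tau_i+T$ if $x(\tau_i)=0$. (3) Parameter update (batch least-squares identifier): with $$p(t,s)=x(t)-x(s)-\int_s^t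 f(x(r),u(r))\,dr,\qquad q(t,s)=\int_s^t g(x(r),u(r))\,dr,$$ $\hat\theta(\tau_{i+1})$ is the unique minimizer of $|\vartheta-\hat\theta(\tau_i)|^2$ over all $\vartheta\in\Theta$ satisfying $$\int_0^{\tau_{i+1}}\!\!\int_0^{\tau_{i+1}} q'(t,s)p(t,s)\,ds\,dt=\Big(\int_0^{\tau_{i+1}}\!\!\int_0^{\tau_{i+1}} q'(t,s)q(t,s)\,ds\,dt\Big)\vartheta .$$ (The constraint set is non-empty, since it contains $\theta$.) *)

theory Defs
  imports "HOL-Analysis.Analysis"
begin

text \<open>\<open>Ck_on\<close> is meant for open \<open>U\<close>: all partial derivatives up to order \<open>k\<close> exist
  and are continuous.\<close>

primrec Ck_on :: "nat \<Rightarrow> ('a::euclidean_space \<Rightarrow> 'b::real_normed_vector) \<Rightarrow> 'a set \<Rightarrow> bool" where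
  "Ck_on 0 h U \<longleftrightarrow> continuous_on U h"
| "Ck_on (Suc k) h U \<longleftrightarrow>
     (\<forall>x\<in>U. h differentiable (at x)) \<and>
     (\<forall>v. Ck_on k (\<lambda>x. frechet_derivative h (at x) v) U)"

text \<open>On a set that need not be open (such as \<open>\<Theta> \<times> UNIV\<close> with \<open>\<Theta>\<close> closed), a map is smooth if
  it extends, near each point of the set, to a \<open>C\<^sup>\<infinity>\<close> map on an open set.\<close>

definition smooth_on :: "('a::euclidean_space \<Rightarrow> 'b::real_normed_vector) \<Rightarrow> 'a set \<Rightarrow> bool" where
  "smooth_on h S \<longleftrightarrow>
     (\<forall>x\<in>S. \<exists>U H. open U \<and> x \<in> U \<and> (\<forall>k. Ck_on k H U) \<and> (\<forall>y\<in>S \<inter> U. H y = h y))"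

definition grad :: "('a::real_inner \<Rightarrow> real) \<Rightarrow> 'a \<Rightarrow> 'a" where
  "grad h x = (THE D. GDERIV h x :> D)"

definition continuously_differentiable :: "('a::real_inner \<Rightarrow> real) \<Rightarrow> bool" where
  "continuously_differentiable h \<longleftrightarrow>
     (\<forall>x. \<exists>D. GDERIV h x :> D) \<and> continuous_on UNIV (grad h)"

definition positive_definite :: "('a::real_normed_vector \<Rightarrow> real) \<Rightarrow> bool" where
  "positive_definite W \<longleftrightarrow> W 0 = 0 \<and> (\<forall>x. x \<noteq> 0 \<longrightarrow> W x > 0)"

definition radially_unbounded :: "('a::real_normed_vector \<Rightarrow> real) \<Rightarrow> bool" where
  "radially_unbounded W \<longleftrightarrow> (\<forall>M>0. compact {x. W x \<le> M})"

text \<open>Solutions of the autonomous equation with right-hand side \<open>F\<close> on the time set \<open>I\<close>;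
  derivatives are one-sided at end points belonging to \<open>I\<close>.\<close>

definition ode_solution ::
  "('a::real_normed_vector \<Rightarrow> 'a) \<Rightarrow> real set \<Rightarrow> (real \<Rightarrow> 'a) \<Rightarrow> bool" where
  "ode_solution F I x \<longleftrightarrow> (\<forall>t\<in>I. (x has_vector_derivative F (x t)) (at t within I))"

definition forward_complete :: "('a::real_normed_vector \<Rightarrow> 'a) \<Rightarrow> bool" where
  "forward_complete F \<longleftrightarrow> (\<forall>\<xi>. \<exists>x. ode_solution F {0..} x \<and> x 0 = \<xi>)"

definition globally_asymptotically_stable :: "('a::real_normed_vector \<Rightarrow> 'a) \<Rightarrow> bool" where
  "globally_asymptotically_stable F \<longleftrightarrow>
     forward_complete F \<and>
     (\<forall>\<epsilon>>0. \<exists>\<delta>>0. \<forall>x. ode_solution F {0..} x \<and> norm (x 0) < \<delta> \<longrightarrow> (\<forall>t\<ge>0. norm (x t) < \<epsilon>)) \<and>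
     (\<forall>x. ode_solution F {0..} x \<longrightarrow> (x \<longlongrightarrow> 0) at_top)"

definition globally_exponentially_stable :: "('a::real_normed_vector \<Rightarrow> 'a) \<Rightarrow> bool" where
  "globally_exponentially_stable F \<longleftrightarrow>
     forward_complete F \<and>
     (\<exists>M>0. \<exists>\<omega>>0. \<forall>x. ode_solution F {0..} x \<longrightarrow>
        (\<forall>t\<ge>0. norm (x t) \<le> M * exp (- \<omega> * t) * norm (x 0)))"

definition plant ::
  "(real^'n \<Rightarrow> real^'m \<Rightarrow> real^'n) \<Rightarrow> (real^'n \<Rightarrow> real^'m \<Rightarrow> real^'l^'n) \<Rightarrow>
   real^'l \<Rightarrow> real^'n \<Rightarrow> real^'m \<Rightarrow> real^'n" where
  "plant f g \<theta> x u = f x u + g x u *v \<theta>"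

text \<open>The state \<open>x\<close> follows the plant with parameter \<open>\<theta>\<close> from \<open>\<xi>\<close> at time \<open>s\<close>, the control
  using the frozen estimate \<open>\<eta>\<close>; \<open>trigger_time\<close> is the time \<open>r\<^sub>i\<close> for \<open>s = \<tau>\<^sub>i\<close>,
  \<open>\<xi> = x(\<tau>\<^sub>i)\<close>. The infimum of the empty set is \<open>\<infinity>\<close> in \<open>ereal\<close>.\<close>

definition hit_times ::
  "(real^'n \<Rightarrow> real^'m \<Rightarrow> real^'n) \<Rightarrow> (real^'n \<Rightarrow> real^'m \<Rightarrow> real^'l^'n) \<Rightarrow>
   (real^'l \<Rightarrow> real^'n \<Rightarrow> real^'m) \<Rightarrow> (real^'l \<Rightarrow> real^'n \<Rightarrow> real) \<Rightarrow> (real^'n \<Rightarrow> real) \<Rightarrow>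
   real^'l \<Rightarrow> real^'l \<Rightarrow> real \<Rightarrow> real^'n \<Rightarrow> real set" where
  "hit_times f g k V a \<theta> \<eta> s \<xi> =
     {t. t > s \<and> (\<exists>y. y s = \<xi> \<and> ode_solution (\<lambda>z. plant f g \<theta> z (k \<eta> z)) {s..t} y \<and>
                      V \<eta> (y t) = V \<eta> \<xi> + a \<xi>)}"

definition trigger_time ::
  "(real^'n \<Rightarrow> real^'m \<Rightarrow> real^'n) \<Rightarrow> (real^'n \<Rightarrow> real^'m \<Rightarrow> real^'l^'n) \<Rightarrow>
   (real^'l \<Rightarrow> real^'n \<Rightarrow> real^'m) \<Rightarrow> (real^'l \<Rightarrow> real^'n \<Rightarrow> real) \<Rightarrow> (real^'n \<Rightarrow> real) \<Rightarrow> real \<Rightarrow>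
   real^'l \<Rightarrow> real^'l \<Rightarrow> real \<Rightarrow> real^'n \<Rightarrow> ereal" where
  "trigger_time f g k V a T \<theta> \<eta> s \<xi> =
     (if \<xi> = 0 then ereal (s + T) else Inf (ereal ` hit_times f g k V a \<theta> \<eta> s \<xi>))"

text \<open>Interval integrals are oriented: for \<open>t < s\<close> the integral from \<open>s\<close> to \<open>t\<close> is minus the
  integral from \<open>t\<close> to \<open>s\<close>.\<close>

definition p_signal ::
  "(real^'n \<Rightarrow> real^'m \<Rightarrow> real^'n) \<Rightarrow> (real \<Rightarrow> real^'n) \<Rightarrow> (real \<Rightarrow> real^'m) \<Rightarrow>
   real \<Rightarrow> real \<Rightarrow> real^'n" where
  "p_signal f x u t s = x t - x s - (LBINT r=ereal s..ereal t. f (x r) (u r))"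

definition q_signal ::
  "(real^'n \<Rightarrow> real^'m \<Rightarrow> real^'l^'n) \<Rightarrow> (real \<Rightarrow> real^'n) \<Rightarrow> (real \<Rightarrow> real^'m) \<Rightarrow>
   real \<Rightarrow> real \<Rightarrow> real^'l^'n" where
  "q_signal g x u t s = (LBINT r=ereal s..ereal t. g (x r) (u r))"

definition least_squares_set ::
  "(real^'l) set \<Rightarrow> (real^'n \<Rightarrow> real^'m \<Rightarrow> real^'n) \<Rightarrow> (real^'n \<Rightarrow> real^'m \<Rightarrow> real^'l^'n) \<Rightarrow>
   (real \<Rightarrow> real^'n) \<Rightarrow> (real \<Rightarrow> real^'m) \<Rightarrow> real \<Rightarrow> (real^'l) set" where
  "least_squares_set \<Theta> f g x u b =
     {\<eta> \<in> \<Theta>.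
        (LBINT t=ereal 0..ereal b. (LBINT s=ereal 0..ereal b.
           transpose (q_signal g x u t s) *v p_signal f x u t s)) =
        (LBINT t=ereal 0..ereal b. (LBINT s=ereal 0..ereal b.
           transpose (q_signal g x u t s) ** q_signal g x u t s)) *v \<eta>}"

text \<open>A solution is described by the state \<open>x\<close>, the estimate \<open>h\<close> and the event times \<open>\<tau>\<close>. It
  lives on the union of the intervals between events; that this union is the whole half line
  (no accumulation of events) is not part of the definition. Values of \<open>x\<close> and \<open>h\<close> outside
  the union are irrelevant.\<close>

definition solution_domain :: "(nat \<Rightarrow> real) \<Rightarrow> real set" where
  "solution_domain \<tau> = (\<Union>i. {\<tau> i..<\<tau> (Suc i)})"

definition hybrid_solution ::
  "(real^'l) set \<Rightarrow> (real^'n \<Rightarrow> real^'m \<Rightarrow> real^'n) \<Rightarrow> (real^'n \<Rightarrow> real^'m \<Rightarrow> real^'l^'n) \<Rightarrow>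
   (real^'l \<Rightarrow> real^'n \<Rightarrow> real^'m) \<Rightarrow> (real^'l \<Rightarrow> real^'n \<Rightarrow> real) \<Rightarrow> (real^'n \<Rightarrow> real) \<Rightarrow> real \<Rightarrow>
   real^'l \<Rightarrow> (real \<Rightarrow> real^'n) \<Rightarrow> (real \<Rightarrow> real^'l) \<Rightarrow> (nat \<Rightarrow> real) \<Rightarrow> bool" where
  "hybrid_solution \<Theta> f g k V a T \<theta> x h \<tau> \<longleftrightarrow>
     \<tau> 0 = 0 \<and> (\<forall>i. \<tau> i < \<tau> (Suc i)) \<and>
     continuous_on (solution_domain \<tau>) x \<and>
     (\<forall>t\<in>solution_domain \<tau>. h t \<in> \<Theta>) \<and>
     (\<forall>i. (\<forall>t\<in>{\<tau> i..<\<tau> (Suc i)}. h t = h (\<tau> i)) \<and>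
          ode_solution (\<lambda>z. plant f g \<theta> z (k (h (\<tau> i)) z)) {\<tau> i..<\<tau> (Suc i)} x) \<and>
     (\<forall>i. ereal (\<tau> (Suc i)) =
          min (ereal (\<tau> i + T)) (trigger_time f g k V a T \<theta> (h (\<tau> i)) (\<tau> i) (x (\<tau> i)))) \<and>
     (\<forall>i \<eta>. is_arg_min (\<lambda>\<zeta>. (norm (\<zeta> - h (\<tau> i)))\<^sup>2)
               (\<lambda>\<zeta>. \<zeta> \<in> least_squares_set \<Theta> f g x (\<lambda>t. k (h t) (x t)) (\<tau> (Suc i))) \<eta>
             \<longleftrightarrow> \<eta> = h (\<tau> (Suc i)))"

end

theory Submission
  imports Defs
begin

text \<open>Along a solution the data satisfy \<open>p(t,s) = q(t,s) \<theta>\<close>, so the estimate after an event is the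
  projection of the previous one onto \<open>\<Theta> \<inter> (\<theta> + N)\<close>, where \<open>N\<close> is the common kernel of all matrices
  \<open>g(x,u)\<close> seen so far. The subspace \<open>N\<close> only shrinks. If it does not shrink during an interval between
  events, then the current estimate \<open>\<eta>\<close> is kept and produces the same vector field as \<open>\<theta>\<close> there,
  whence \<open>V(\<eta>,x)\<close> decays at rate \<open>2\<sigma>\<close>, the trigger level is not reached, and the interval has length
  \<open>T\<close>. All but at most \<open>l\<close> intervals are of this kind. This rules out accumulation of events, and each
  exceptional interval costs a constant factor, because the trigger level bounds \<open>V(\<eta>,x)\<close> and the
  estimates stay in the ball around \<open>\<theta>\<close> through the initial one, where \<open>V\<close> is uniformly
  quadratic.\<close>

section \<open>Smooth maps are locally Lipschitz\<close>

text \<open>The estimate need not converge to \<open>\<theta>\<close>; what can be kept is that past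
  data do not distinguish the two. With a wrong estimate the closed loop may grow, or even escape in
  finite time without the trigger, and an interval that reveals new information has no a priori
  lower bound on its length. The dimension count replaces such a bound: a decreasing chain of
  subspaces of an \<open>l\<close>-dimensional space has at most \<open>l\<close> strict steps. The
  estimates cannot leave the ball because \<open>\<theta>\<close> lies in every set projected onto
  and nearest-point maps are nonexpansive. The rate \<open>\<sigma>\<close> is kept without loss: a
  non-exceptional interval leaves the function \<open>V \<eta>\<close> unchanged and costs no
  constant, while an exceptional one lasts at most \<open>T\<close>, so its missing decay is worth
  at most \<open>exp (2 * \<sigma> * T)\<close>. Absence of accumulation is not built into the
  notion of solution, so a solution is constructed by recursion over events, shown to fill the half
  line, and compared with any other one.\<close>

lemma Ck_on_1_lipschitz_ball:
  fixes H :: "'a::euclidean_space \<Rightarrow> 'b::real_normed_vector"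
  assumes H: "Ck_on 1 H U" and U: "open U" "x \<in> U"
  shows "\<exists>u>0. cball x u \<subseteq> U \<and> (\<exists>L. L-lipschitz_on (cball x u) H)"
proof -
  obtain u where u: "u > 0" "cball x u \<subseteq> U"
    using U open_contains_cball by blast
  define D where "D y = frechet_derivative H (at y)" for y
  have D: "(H has_derivative D y) (at y)" if "y \<in> U" for y
    using H that frechet_derivative_works by (auto simp: D_def)
  have "\<exists>B. \<forall>y\<in>cball x u. norm (D y b) \<le> B" for b
  proof -
    have "continuous_on (cball x u) (\<lambda>y. D y b)"
      using H u(2) by (auto simp: D_def intro: continuous_on_subset)
    then have "bounded ((\<lambda>y. D y b) ` cball x u)"
      by (simp add: compact_continuous_image compact_imp_bounded)
    then show ?thesis by (auto simp: bounded_iff)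
  qed
  then obtain B where B: "norm (D y b) \<le> B b" if "y \<in> cball x u" for y b
    by metis
  \<comment> \<open>\<open>Ck_on\<close> gives continuity of the derivative only in each fixed
    direction, so the operator norm is controlled through the finitely many basis
    directions.\<close>
  define L where "L = (\<Sum>b\<in>Basis. B b)"
  have on: "onorm (D y) \<le> L" if "y \<in> cball x u" for y
  proof -
    have "bounded_linear (D y)"
      using D u(2) that has_derivative_bounded_linear by blast
    then have "onorm (D y) \<le> (\<Sum>b\<in>Basis. norm (D y b))"
      by (rule onorm_componentwise)
    also have "\<dots> \<le> L"
      unfolding L_def by (intro sum_mono B that)
    finally show ?thesis .
  qed
  have "0 \<le> norm (D x b)" for b by simp
  then have "L \<ge> 0"
    unfolding L_def using B[of x] u(1) by (intro sum_nonneg) (meson centre_in_cball less_imp_le norm_ge_zero order_trans)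
  moreover have "norm (H y - H z) \<le> L * norm (y - z)" if "y \<in> cball x u" "z \<in> cball x u" for y z
    by (rule differentiable_bound[where S = "cball x u" and f' = D])
       (use D[THEN has_derivative_at_withinI] u(2) on that in auto)
  ultimately have "L-lipschitz_on (cball x u) H"
    by (intro lipschitz_onI) (auto simp: dist_norm)
  with u show ?thesis by blast
qed

text \<open>\<open>K\<close> need not be convex, so the mean value inequality does not apply on it
  directly; the local constants of the extensions \<open>H\<close> are merged by compactness. The
  time set \<open>{0}\<close> fits the autonomous map into \<open>local_lipschitz\<close>.\<close>

lemma smooth_on_imp_lipschitz_on_compact:
  fixes h :: "'a::euclidean_space \<Rightarrow> 'b::real_normed_vector"
  assumes h: "smooth_on h S" and K: "compact K" "K \<subseteq> S"
  obtains L where "L-lipschitz_on K h"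
proof -
  have "local_lipschitz {0::real} S (\<lambda>_. h)"
  proof (rule local_lipschitzI)
    fix t x assume "x \<in> S"
    then obtain U H where U: "open U" "x \<in> U" and H: "\<forall>k. Ck_on k H U" "\<forall>y\<in>S \<inter> U. H y = h y"
      using h unfolding smooth_on_def by meson
    obtain u L where u: "u > 0" "cball x u \<subseteq> U" "L-lipschitz_on (cball x u) H"
      using Ck_on_1_lipschitz_ball[of H U x] H(1) U by blast
    have "L-lipschitz_on (cball x u \<inter> S) h"
      by (rule lipschitz_on_transform[OF lipschitz_on_subset[OF u(3)]]) (use H(2) u(2) in auto)
    with u(1) show "\<exists>u>0. \<exists>L. \<forall>t\<in>cball t u \<inter> {0}. L-lipschitz_on (cball x u \<inter> S) h"
      by blast
  qed
  then have "local_lipschitz {0::real} K (\<lambda>_. h)"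
    using K(2) local_lipschitz_subset by blast
  then show thesis
    using local_lipschitz_compact_implies_lipschitz[of "{0::real}" K "\<lambda>_. h"] K(1) that
    by (metis compact_sing continuous_on_const singletonI)
qed

lemma smooth_on_UNIV_imp_continuous_on:
  fixes h :: "'a::euclidean_space \<Rightarrow> 'b::real_normed_vector"
  assumes "smooth_on h UNIV"
  shows "continuous_on A h"
proof -
  have "isCont h z" for z
  proof -
    obtain L where "L-lipschitz_on (cball z 1) h"
      using smooth_on_imp_lipschitz_on_compact[OF assms compact_cball] by blast
    then have "continuous_on (ball z 1) h"
      using lipschitz_on_continuous_on continuous_on_subset ball_subset_cball by blast
    then show ?thesis
      by (simp add: continuous_on_eq_continuous_at)
  qed
  then show ?thesis by (simp add: continuous_at_imp_continuous_on)
qed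

section \<open>Autonomous differential equations\<close>

text \<open>Global existence comes from the Banach fixed point theorem for
  \<open>w t = exp (- lam t) (x t - \<xi>)\<close>, where the weight makes the Picard operator a contraction
  on the whole half line.\<close>

lemma ode_solution_exists_bounded_lipschitz:
  fixes F :: "'a::euclidean_space \<Rightarrow> 'a"
  assumes lip: "L-lipschitz_on UNIV F" and bd: "\<And>z. norm (F z) \<le> B"
  obtains y where "y 0 = \<xi>" "ode_solution F {0..} y"
proof -
  \<comment> \<open>The weighted Picard operator has Lipschitz constant at most
    \<open>L / lam\<close>, hence at most 1/2; the summand 1 keeps \<open>lam\<close> positive when
    \<open>L = 0\<close>.\<close>
  define lam where "lam = 2 * (L + 1)"
  have L0: "L \<ge> 0" using lip lipschitz_on_nonneg by blast
  have l0: "lam > 0" using L0 by (simp add: lam_def)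
  have F_cont: "continuous_on A F" for A
    using lip lipschitz_on_continuous_on continuous_on_subset by blast
  define G where "G w s = F (\<xi> + exp (lam * s) *\<^sub>R apply_bcontfun w s)"
    for w :: "real \<Rightarrow>\<^sub>C 'a" and s
  have G_cont: "continuous_on A (G w)" for w A
    unfolding G_def by (intro continuous_on_compose2[OF F_cont[of UNIV]] continuous_intros) auto
  have G_int: "G w integrable_on {a..b}" for w a b
    by (intro integrable_continuous_real G_cont)
  have B0: "B \<ge> 0" using bd[of 0] norm_ge_zero order_trans by blast
  \<comment> \<open>The Banach space consists of functions on the whole line, so the operator is
    continued constantly to negative times by \<open>max 0 t\<close>.\<close>
  define P where "P w t = exp (- lam * max 0 t) *\<^sub>R integral {0..max 0 t} (G w)" for w t
  have I_cont: "continuous_on {0..} (\<lambda>t. integral {0..t} (G w))" for w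
    unfolding continuous_on_eq_continuous_within
  proof
    fix t :: real assume t: "t \<in> {0..}"
    have "continuous_on {0..t+1} (\<lambda>t. integral {0..t} (G w))"
      by (rule indefinite_integral_continuous_1[OF G_int])
    then have "continuous (at t within {0..t+1}) (\<lambda>t. integral {0..t} (G w))"
      using t by (auto simp: continuous_on_eq_continuous_within)
    moreover have "at t within {0..t+1} = at t within {0..}"
      by (rule at_within_nhd[of _ "{..<t+1}"]) auto
    ultimately show "continuous (at t within {0..}) (\<lambda>t. integral {0..t} (G w))"
      by simp
  qed
  have P_cont: "continuous_on UNIV (P w)" for w
    unfolding P_def
    by (intro continuous_intros continuous_on_compose2[OF I_cont]) auto
  have P_bd: "norm (P w t) \<le> B / lam" for w t
  proof -
    define r where "r = max 0 t"
    have r: "r \<ge> 0" by (simp add: r_def)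
    have "norm (integral {0..r} (G w)) \<le> B * (r - 0)"
      using r by (intro integral_bound G_cont) (auto simp: G_def bd)
    then have "norm (P w t) \<le> exp (- lam * r) * (B * r)"
      unfolding P_def r_def[symmetric] by simp
    also have "\<dots> \<le> B / lam"
    proof -
      have "lam * r \<le> exp (lam * r)" using exp_ge_add_one_self[of "lam * r"] by linarith
      then have "r * exp (- lam * r) \<le> 1 / lam"
        using l0 by (simp add: exp_minus field_simps)
      from mult_left_mono[OF this B0] show ?thesis by (simp add: mult_ac)
    qed
    finally show ?thesis .
  qed
  have P_mem: "P w \<in> bcontfun" for w
    by (rule bcontfun_normI[OF P_cont P_bd])
  define Q where "Q w = Bcontfun (P w)" for w
  have Q: "apply_bcontfun (Q w) = P w" for w
    unfolding Q_def by (rule Bcontfun_inverse[OF P_mem])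
  have "dist (Q w) (Q w') \<le> (1/2) * dist w w'" for w w'
  proof (rule dist_bound)
    fix t :: real
    define r where "r = max 0 t"
    have r: "r \<ge> 0" by (simp add: r_def)
    have ineq: "norm (G w s - G w' s) \<le> L * dist w w' * exp (lam * s)" for s
    proof -
      have "norm (G w s - G w' s) \<le> L * norm (exp (lam * s) *\<^sub>R (apply_bcontfun w s - apply_bcontfun w' s))"
        using lipschitz_on_normD[OF lip UNIV_I UNIV_I,
            of "\<xi> + exp (lam * s) *\<^sub>R apply_bcontfun w s" "\<xi> + exp (lam * s) *\<^sub>R apply_bcontfun w' s"]
        by (simp add: G_def scaleR_diff_right)
      also have "\<dots> = L * exp (lam * s) * dist (apply_bcontfun w s) (apply_bcontfun w' s)"
        by (simp add: dist_norm)
      also have "\<dots> \<le> L * exp (lam * s) * dist w w'"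
        using L0 by (intro mult_left_mono dist_bounded) auto
      finally show ?thesis by (simp add: mult_ac)
    qed
    have ei: "((\<lambda>s. exp (lam * s)) has_integral (exp (lam * r) / lam - exp (lam * 0) / lam)) {0..r}"
      using l0 r
      by (intro fundamental_theorem_of_calculus)
         (auto intro!: derivative_eq_intros simp: has_real_derivative_iff_has_vector_derivative[symmetric])
    have "norm (integral {0..r} (G w) - integral {0..r} (G w')) = norm (integral {0..r} (\<lambda>s. G w s - G w' s))"
      by (simp add: integral_diff G_int)
    also have "\<dots> \<le> integral {0..r} (\<lambda>s. L * dist w w' * exp (lam * s))"
      by (intro integral_norm_bound_integral ineq integrable_diff G_int integrable_continuous_real continuous_intros)
    also have "\<dots> = L * dist w w' * (exp (lam * r) / lam - exp (lam * 0) / lam)"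
      using ei by (simp add: integral_unique)
    also have "\<dots> \<le> L * dist w w' * (exp (lam * r) / lam)"
      using L0 l0 by (intro mult_left_mono) auto
    finally have *: "norm (integral {0..r} (G w) - integral {0..r} (G w')) \<le> L * dist w w' * (exp (lam * r) / lam)" .
    have "dist (P w t) (P w' t) = exp (- lam * r) * norm (integral {0..r} (G w) - integral {0..r} (G w'))"
      unfolding P_def r_def[symmetric] dist_norm by (simp flip: scaleR_diff_right)
    also have "\<dots> \<le> exp (- lam * r) * (L * dist w w' * (exp (lam * r) / lam))"
      by (intro mult_left_mono *) auto
    also have "\<dots> = L / lam * dist w w'"
      by (simp add: exp_minus field_simps)
    also have "\<dots> \<le> (1/2) * dist w w'"
      using L0 by (intro mult_right_mono) (auto simp: lam_def field_simps)
    finally show "dist (apply_bcontfun (Q w) t) (apply_bcontfun (Q w') t) \<le> (1/2) * dist w w'"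
      by (simp add: Q)
  qed
  then obtain w where w: "Q w = w"
    using banach_fix_type[of "1/2" Q] by auto
  define y where "y t = \<xi> + exp (lam * t) *\<^sub>R apply_bcontfun w t" for t
  have y_eq: "y t = \<xi> + integral {0..t} (\<lambda>s. F (y s))" if "t \<ge> 0" for t
  proof -
    have "apply_bcontfun w t = exp (- lam * t) *\<^sub>R integral {0..t} (G w)"
      using Q[of w] w that by (simp add: P_def)
    then show ?thesis
      by (simp add: y_def G_def[abs_def] exp_minus)
  qed
  have Fy_cont: "continuous_on A (\<lambda>s. F (y s))" for A
    using G_cont[of A w] by (simp add: y_def G_def[abs_def])
  have "ode_solution F {0..} y"
    unfolding ode_solution_def
  proof
    fix t :: real assume t: "t \<in> {0..}"
    have "((\<lambda>t. \<xi> + integral {0..t} (\<lambda>s. F (y s))) has_vector_derivative F (y t)) (at t within {0..t+1})"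
      using t by (auto intro!: derivative_eq_intros integral_has_vector_derivative Fy_cont)
    moreover have "at t within {0..t+1} = at t within {0..}"
      by (rule at_within_nhd[of _ "{..<t+1}"]) auto
    ultimately have "((\<lambda>t. \<xi> + integral {0..t} (\<lambda>s. F (y s))) has_vector_derivative F (y t)) (at t within {0..})"
      by simp
    then show "(y has_vector_derivative F (y t)) (at t within {0..})"
      by (rule has_vector_derivative_transform[OF t, rotated]) (simp add: y_eq)
  qed
  moreover have "y 0 = \<xi>" using y_eq[of 0] by simp
  ultimately show thesis using that by blast
qed

lemma ode_solution_subset: "ode_solution F I x \<Longrightarrow> J \<subseteq> I \<Longrightarrow> ode_solution F J x"
  unfolding ode_solution_def using has_vector_derivative_within_subset by blast

lemma ode_solution_continuous_on: "ode_solution F I x \<Longrightarrow> continuous_on I x"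
  unfolding ode_solution_def continuous_on_eq_continuous_within
  using has_vector_derivative_continuous by blast

lemma ode_solution_interior:
  assumes "ode_solution F {a..b} x" "a < t" "t < b"
  shows "(x has_vector_derivative F (x t)) (at t)"
  using assms by (auto simp: ode_solution_def at_within_Icc_at[symmetric])

lemma ode_solution_cong:
  assumes "ode_solution F I x" "\<And>t. t \<in> I \<Longrightarrow> x' t = x t" "\<And>t. t \<in> I \<Longrightarrow> F' (x t) = F (x t)"
  shows "ode_solution F' I x'"
  unfolding ode_solution_def
proof
  fix t assume t: "t \<in> I"
  then have "(x has_vector_derivative F (x t)) (at t within I)"
    using assms(1) by (simp add: ode_solution_def)
  then have "(x' has_vector_derivative F (x t)) (at t within I)"
    by (rule has_vector_derivative_transform[OF t, rotated]) (simp add: assms)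
  then show "(x' has_vector_derivative F' (x' t)) (at t within I)"
    using t assms by simp
qed

lemma ode_solution_shift:
  assumes "ode_solution F ((\<lambda>t. t - c) ` I) x"
  shows "ode_solution F I (\<lambda>t. x (t - c))"
  unfolding ode_solution_def
proof
  fix t assume t: "t \<in> I"
  have "(x has_vector_derivative F (x (t - c))) (at (t - c) within (\<lambda>t. t - c) ` I)"
    using assms t by (auto simp: ode_solution_def)
  moreover have "((\<lambda>t. t - c) has_vector_derivative 1) (at t within I)"
    by (auto intro!: derivative_eq_intros)
  ultimately show "((\<lambda>t. x (t - c)) has_vector_derivative F (x (t - c))) (at t within I)"
    using vector_diff_chain_within[of "\<lambda>t. t - c" 1 t I x "F (x (t - c))"] by (simp add: o_def)
qed

text \<open>Gronwall: the squared distance times \<open>exp (- 2 * L * r)\<close> does not increase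
  and starts at 0. A Lipschitz constant on compact sets is enough, because on a compact interval
  both trajectories stay in one compact set.\<close>

lemma ode_solution_unique:
  fixes F :: "'a::euclidean_space \<Rightarrow> 'a"
  assumes lip: "\<And>K. compact K \<Longrightarrow> \<exists>L. L-lipschitz_on K F"
    and x: "ode_solution F {a..b} x" and y: "ode_solution F {a..b} y" and init: "x a = y a"
    and t: "t \<in> {a..b}"
  shows "x t = y t"
proof -
  have cx: "continuous_on {a..b} x" and cy: "continuous_on {a..b} y"
    using x y by (auto intro: ode_solution_continuous_on)
  have "compact (x ` {a..b} \<union> y ` {a..b})"
    using cx cy by (intro compact_Un compact_continuous_image) auto
  then obtain L where L: "L-lipschitz_on (x ` {a..b} \<union> y ` {a..b}) F"
    using lip by blast
  define w where "w r = exp (- 2 * L * r) * ((x r - y r) \<bullet> (x r - y r))" for r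
  have "w t \<le> w a"
  proof (rule DERIV_nonpos_imp_decreasing_open[where f = w])
    show "a \<le> t" using t by simp
    show "continuous_on {a..t} w"
      unfolding w_def using t
      by (intro continuous_intros continuous_on_subset[OF cx] continuous_on_subset[OF cy]) auto
    fix r assume r: "a < r" "r < t"
    then have rb: "r < b" using t by simp
    note dx = ode_solution_interior[OF x r(1) rb] and dy = ode_solution_interior[OF y r(1) rb]
    define d where "d = x r - y r"
    have "(x r - y r) \<bullet> (F (x r) - F (y r)) \<le> norm d * norm (F (x r) - F (y r))"
      unfolding d_def by (rule norm_cauchy_schwarz)
    also have "\<dots> \<le> norm d * (L * norm d)"
      unfolding d_def using r rb by (intro mult_left_mono lipschitz_on_normD[OF L]) auto
    finally have le: "d \<bullet> (F (x r) - F (y r)) \<le> L * (d \<bullet> d)"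
      by (simp add: d_def power2_norm_eq_inner[symmetric] power2_eq_square mult_ac)
    have d1: "((\<lambda>r. x r - y r) has_derivative (\<lambda>h. h *\<^sub>R (F (x r) - F (y r)))) (at r)"
      using has_vector_derivative_diff[OF dx dy] by (simp add: has_vector_derivative_def)
    have "((\<lambda>r. (x r - y r) \<bullet> (x r - y r)) has_real_derivative 2 * (d \<bullet> (F (x r) - F (y r)))) (at r)"
      using has_derivative_inner[OF d1 d1]
      unfolding has_field_derivative_def d_def[symmetric]
      by (rule has_derivative_eq_rhs) (auto simp: fun_eq_iff inner_commute algebra_simps)
    then have "(w has_real_derivative
       exp (- 2 * L * r) * (2 * (d \<bullet> (F (x r) - F (y r)))) - 2 * L * exp (- 2 * L * r) * (d \<bullet> d)) (at r)"
      unfolding w_def d_def by (auto intro!: derivative_eq_intros)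
    moreover have "exp (- 2 * L * r) * (2 * (d \<bullet> (F (x r) - F (y r)))) - 2 * L * exp (- 2 * L * r) * (d \<bullet> d)
        = 2 * exp (- 2 * L * r) * (d \<bullet> (F (x r) - F (y r)) - L * (d \<bullet> d))"
      by (simp add: algebra_simps)
    moreover have "\<dots> \<le> 0"
      using le by (intro mult_nonneg_nonpos) auto
    ultimately show "\<exists>z. (w has_real_derivative z) (at r) \<and> z \<le> 0"
      by auto
  qed
  also have "w a = 0" by (simp add: w_def init)
  finally have "exp (- 2 * L * t) * ((x t - y t) \<bullet> (x t - y t)) \<le> 0"
    by (simp add: w_def)
  then have "(x t - y t) \<bullet> (x t - y t) \<le> 0"
    by (simp add: mult_le_0_iff)
  then show ?thesis
    by (metis antisym inner_eq_zero_iff inner_ge_zero right_minus_eq)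
qed

section \<open>Gradients and decay of Lyapunov functions along trajectories\<close>

lemma GDERIV_grad:
  assumes "continuously_differentiable h"
  shows "GDERIV h x :> grad h x"
proof -
  obtain D where D: "GDERIV h x :> D"
    using assms unfolding continuously_differentiable_def by blast
  have "E = D" if "GDERIV h x :> E" for E
  proof -
    have "(\<lambda>y. y \<bullet> D) = (\<lambda>y. y \<bullet> E)"
      using D that unfolding gderiv_def by (rule has_derivative_unique)
    then have "(E - D) \<bullet> (E - D) = 0"
      by (metis inner_diff_right right_minus_eq)
    then show ?thesis by simp
  qed
  with D have "grad h x = D"
    unfolding grad_def by blast
  with D show ?thesis by simp
qed

lemma continuously_differentiable_imp_continuous_on:
  assumes "continuously_differentiable h"
  shows "continuous_on A h"
  using GDERIV_grad[OF assms]
  by (meson continuous_at_imp_continuous_on gderiv_def has_derivative_continuous)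

text \<open>The integrating factor \<open>exp (c * (r - a))\<close> makes the product nonincreasing.
  The inequality is required only in the interior, and continuity carries the conclusion to the end
  points; this suits the half-open intervals on which the kernel condition is available.\<close>

lemma lyapunov_decay:
  fixes W :: "'a::euclidean_space \<Rightarrow> real"
  assumes W: "continuously_differentiable W" and y: "ode_solution F {a..b} y"
    and decay: "\<And>t. a < t \<Longrightarrow> t < b \<Longrightarrow> grad W (y t) \<bullet> F (y t) \<le> - c * W (y t)"
    and t: "t \<in> {a..b}"
  shows "W (y t) \<le> exp (- c * (t - a)) * W (y a)"
proof -
  define w where "w r = exp (c * (r - a)) * W (y r)" for r
  have "w t \<le> w a"
  proof (rule DERIV_nonpos_imp_decreasing_open[where f = w])
    show "a \<le> t" using t by simp
    show "continuous_on {a..t} w"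
      unfolding w_def using t
      by (intro continuous_intros continuous_on_compose2[OF continuously_differentiable_imp_continuous_on[OF W, of UNIV]]
            continuous_on_subset[OF ode_solution_continuous_on[OF y]]) auto
    fix r assume r: "a < r" "r < t"
    then have rb: "r < b" using t by simp
    have "((W \<circ> y) has_vector_derivative F (y r) \<bullet> grad W (y r)) (at r)"
      using GDERIV_grad[OF W, of "y r"] ode_solution_interior[OF y r(1) rb]
      unfolding gderiv_def
      using vector_derivative_diff_chain_within[of y "F (y r)" r UNIV W] has_derivative_at_withinI by blast
    then have "((\<lambda>r. W (y r)) has_real_derivative grad W (y r) \<bullet> F (y r)) (at r)"
      by (simp add: o_def has_real_derivative_iff_has_vector_derivative inner_commute)
    then have "(w has_real_derivative
       exp (c * (r - a)) * (grad W (y r) \<bullet> F (y r)) + c * exp (c * (r - a)) * W (y r)) (at r)"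
      unfolding w_def by (auto intro!: derivative_eq_intros)
    moreover have "exp (c * (r - a)) * (grad W (y r) \<bullet> F (y r)) + c * exp (c * (r - a)) * W (y r)
       = exp (c * (r - a)) * (grad W (y r) \<bullet> F (y r) + c * W (y r))"
      by (simp add: algebra_simps)
    moreover have "\<dots> \<le> 0"
      using decay[OF r(1) rb] by (intro mult_nonneg_nonpos) auto
    ultimately show "\<exists>z. (w has_real_derivative z) (at r) \<and> z \<le> 0" by auto
  qed
  then have "exp (- c * (t - a)) * (exp (c * (t - a)) * W (y t)) \<le> exp (- c * (t - a)) * W (y a)"
    by (intro mult_left_mono) (auto simp: w_def)
  then show ?thesis
    by (simp add: mult.assoc[symmetric] exp_add[symmetric])
qed

section \<open>The least-squares identifier\<close>

lemma continuous_on_matrix_matrix_mult [continuous_intros]: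
  fixes A :: "'a::topological_space \<Rightarrow> real^'n^'m" and B :: "'a \<Rightarrow> real^'k^'n"
  assumes "continuous_on S A" "continuous_on S B"
  shows "continuous_on S (\<lambda>x. A x ** B x)"
  unfolding matrix_matrix_mult_def
  by (intro continuous_on_vec_lambda continuous_on_sum continuous_on_mult continuous_on_component assms)

lemma continuous_on_transpose [continuous_intros]:
  fixes A :: "'a::topological_space \<Rightarrow> real^'n^'m"
  assumes "continuous_on S A"
  shows "continuous_on S (\<lambda>x. transpose (A x))"
  unfolding transpose_def
  by (intro continuous_on_vec_lambda continuous_on_component assms)

lemma bounded_linear_matrix_vector_mult_left:
  "bounded_linear (\<lambda>A. (A :: real^'n^'m) *v v)"
  by (intro linear_conv_bounded_linear[THEN iffD1] linearI)
     (auto simp: matrix_vector_mult_add_rdistrib scaleR_matrix_vector_assoc)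

lemmas continuous_on_matrix_vector_mult_left [continuous_intros] =
  bounded_linear.continuous_on[OF bounded_linear_matrix_vector_mult_left]

lemma inner_transpose_mult_self:
  fixes A :: "real^'n^'m"
  shows "v \<bullet> ((transpose A ** A) *v v) = (norm (A *v v))\<^sup>2"
proof -
  have "v \<bullet> ((transpose A ** A) *v v) = (transpose A *v (A *v v)) \<bullet> v"
    by (simp only: matrix_vector_mul_assoc inner_commute)
  also have "\<dots> = (A *v v) \<bullet> (A *v v)"
    by (simp only: transpose_matrix_vector dot_lmul_matrix)
  finally show ?thesis by (simp only: power2_norm_eq_inner)
qed

lemma continuous_on_section:
  assumes "continuous_on (A \<times> B) (\<lambda>(t, s). K t s)" "t \<in> A"
  shows "continuous_on B (K t)"
proof -
  have "continuous_on B (Pair t)"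
    by (intro continuous_on_Pair continuous_on_const continuous_on_id)
  from continuous_on_compose2[OF assms(1) this] show ?thesis
    using assms(2) by auto
qed

text \<open>The input jumps with the estimate at the events, so the signals to be integrated are
  continuous only off a finite set, which is a null set.\<close>

lemma set_integrable_bounded_piecewise_continuous:
  fixes \<phi> :: "real \<Rightarrow> 'a::euclidean_space"
  assumes "finite S" "continuous_on ({a..b} - S) \<phi>" "bounded (\<phi> ` {a..b})"
  shows "set_integrable lborel {a..b} \<phi>"
proof -
  obtain B where "B > 0" and B: "\<And>x. x \<in> {a..b} \<Longrightarrow> norm (\<phi> x) \<le> B"
    using assms(3) unfolding bounded_pos by blast
  have "S \<in> sets borel"
    using assms(1) finite_imp_closed borel_closed by blast
  then have "(\<lambda>x. indicator ({a..b} - S) x *\<^sub>R \<phi> x) \<in> borel_measurable borel"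
    using assms(2) by (intro borel_measurable_continuous_on_indicator) auto
  then have "integrable lborel (\<lambda>x. indicator ({a..b} - S) x *\<^sub>R \<phi> x)"
    by (intro integrableI_bounded_set[of "{a..b}" _ _ B])
       (use \<open>B > 0\<close> in \<open>auto simp: B emeasure_lborel_Icc_eq split: split_indicator\<close>)
  moreover have "(\<lambda>x. indicator {a..b} x *\<^sub>R \<phi> x) \<in> borel_measurable lborel"
    by (rule measurable_discrete_difference[where X = S and f = "\<lambda>x. indicator ({a..b} - S) x *\<^sub>R \<phi> x"])
       (use \<open>(\<lambda>x. indicator ({a..b} - S) x *\<^sub>R \<phi> x) \<in> _\<close> assms(1) in
         \<open>auto intro: countable_finite split: split_indicator\<close>)
  moreover have "AE x in lborel. indicator ({a..b} - S) x *\<^sub>R \<phi> x = indicator {a..b} x *\<^sub>R \<phi> x"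
    using finite_imp_null_set_lborel[OF assms(1)]
    by (intro AE_I'[of S]) (auto split: split_indicator)
  ultimately show ?thesis
    unfolding set_integrable_def by (rule integrable_cong_AE_imp)
qed

text \<open>The signals \<open>p\<close> and \<open>q\<close> use oriented integrals for either
  order of \<open>s\<close> and \<open>t\<close>; a difference of primitives covers both orders with
  one formula.\<close>

lemma interval_integral_eq_diff_integral:
  fixes \<phi> :: "real \<Rightarrow> 'a::euclidean_space"
  assumes \<phi>: "set_integrable lborel {a..b} \<phi>" and st: "s \<in> {a..b}" "t \<in> {a..b}"
  shows "(LBINT r=ereal s..ereal t. \<phi> r) = integral {a..t} \<phi> - integral {a..s} \<phi>"
proof -
  have *: "(LBINT r=ereal s..ereal t. \<phi> r) = integral {a..t} \<phi> - integral {a..s} \<phi>"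
    if "s \<le> t" "s \<in> {a..b}" "t \<in> {a..b}" for s t
  proof -
    have "set_integrable lborel {s..t} \<phi>" "set_integrable lborel {a..t} \<phi>"
      by (rule set_integrable_subset[OF \<phi>]; use that in auto)+
    moreover from this have "\<phi> integrable_on {a..t}"
      using set_borel_integral_eq_integral(1) by blast
    ultimately show ?thesis
      using that Henstock_Kurzweil_Integration.integral_combine[of a s t \<phi>]
      by (simp add: interval_integral_eq_integral algebra_simps)
  qed
  show ?thesis
  proof (cases "s \<le> t")
    case True
    then show ?thesis using * st by simp
  next
    case False
    then show ?thesis
      using *[of t s] st by (simp add: interval_integral_endpoints_reverse[of "ereal s"])
  qed
qed

text \<open>The separate \<open>K'\<close> is meant for expressions in \<open>p_signal\<close> and
  \<open>q_signal\<close>, which are known to equal a continuous kernel only on the square.\<close>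

lemma interval_integral_interval_integral_continuous:
  fixes K :: "real \<Rightarrow> real \<Rightarrow> 'a::euclidean_space"
  assumes "a \<le> b" and K: "continuous_on ({a..b} \<times> {a..b}) (\<lambda>(t, s). K t s)"
    and K': "\<And>t s. t \<in> {a..b} \<Longrightarrow> s \<in> {a..b} \<Longrightarrow> K' t s = K t s"
  shows "(LBINT t=ereal a..ereal b. (LBINT s=ereal a..ereal b. K' t s))
       = integral {a..b} (\<lambda>t. integral {a..b} (K t))"
proof -
  have "(LBINT s=ereal a..ereal b. K' t s) = integral {a..b} (K t)" if t: "t \<in> {a..b}" for t
  proof -
    have "continuous_on {a..b} (K t)"
      using continuous_on_section[OF K t] .
    then show ?thesis
      using \<open>a \<le> b\<close> K'[OF t]
      by (subst interval_integral_cong[where g = "K t"])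
         (auto simp: einterval_def min_def max_def interval_integral_eq_integral borel_integrable_atLeastAtMost')
  qed
  moreover have "continuous_on {a..b} (\<lambda>t. integral {a..b} (K t))"
    using integral_continuous_on_param[of "{a..b}" a b K] K by simp
  ultimately show ?thesis
    using \<open>a \<le> b\<close>
    by (subst interval_integral_cong[where g = "\<lambda>t. integral {a..b} (K t)"])
       (auto simp: einterval_def min_def max_def interval_integral_eq_integral borel_integrable_atLeastAtMost')
qed

lemma integral_integral_eq_0_iff:
  fixes K :: "real \<Rightarrow> real \<Rightarrow> real"
  assumes "a < b" and K: "continuous_on ({a..b} \<times> {a..b}) (\<lambda>(t, s). K t s)"
    and pos: "\<And>t s. K t s \<ge> 0"
  shows "integral {a..b} (\<lambda>t. integral {a..b} (K t)) = 0 \<longleftrightarrow> (\<forall>t\<in>{a..b}. \<forall>s\<in>{a..b}. K t s = 0)"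
proof -
  have cK: "continuous_on {a..b} (K t)" if "t \<in> {a..b}" for t
    using continuous_on_section[OF K that] .
  have "continuous_on {a..b} (\<lambda>t. integral {a..b} (K t))"
    using integral_continuous_on_param[of "{a..b}" a b K] K by simp
  moreover have "integral {a..b} (K t) \<ge> 0" if "t \<in> {a..b}" for t
    by (rule integral_nonneg[OF integrable_continuous_real[OF cK[OF that]] pos])
  ultimately have "integral {a..b} (\<lambda>t. integral {a..b} (K t)) = 0 \<longleftrightarrow> (\<forall>t\<in>{a..b}. integral {a..b} (K t) = 0)"
    using integral_eq_0_iff[of a b "\<lambda>t. integral {a..b} (K t)"] assms(1) by auto
  also have "\<dots> \<longleftrightarrow> (\<forall>t\<in>{a..b}. \<forall>s\<in>{a..b}. K t s = 0)"
    using integral_eq_0_iff[of a b "K t" for t] assms(1) cK pos by auto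
  finally show ?thesis .
qed

text \<open>Along a trajectory \<open>p(t,s) = q(t,s) \<theta>\<close>, so the normal equations say that \<open>\<eta> - \<theta>\<close> lies in the
  kernel of the Gram matrix of \<open>q\<close>, and this kernel is the common kernel of the matrices \<open>g(x,u)\<close>.\<close>

lemma least_squares_set_eq:
  fixes x :: "real \<Rightarrow> real^'n" and u :: "real \<Rightarrow> real^'m"
    and f :: "real^'n \<Rightarrow> real^'m \<Rightarrow> real^'n" and g :: "real^'n \<Rightarrow> real^'m \<Rightarrow> real^'l^'n"
  assumes b: "b > 0" and S: "finite S" and x: "continuous_on {0..b} x"
    and fc: "continuous_on ({0..b} - S) (\<lambda>r. f (x r) (u r))"
    and fb: "bounded ((\<lambda>r. f (x r) (u r)) ` {0..b})"
    and gc: "continuous_on ({0..b} - S) (\<lambda>r. g (x r) (u r))"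
    and gb: "bounded ((\<lambda>r. g (x r) (u r)) ` {0..b})"
    and gr: "\<And>r. r \<in> {0..<b} \<Longrightarrow> continuous (at_right r) (\<lambda>r. g (x r) (u r))"
    and ode: "\<And>r. r \<in> {0<..<b} - S \<Longrightarrow> (x has_vector_derivative plant f g \<theta> (x r) (u r)) (at r)"
  shows "least_squares_set \<Theta> f g x u b = {\<eta>\<in>\<Theta>. \<forall>r\<in>{0..<b}. g (x r) (u r) *v (\<eta> - \<theta>) = 0}"
proof -
  define \<phi> where "\<phi> r = g (x r) (u r)" for r
  define \<psi> where "\<psi> r = f (x r) (u r)" for r
  note intg = set_integrable_bounded_piecewise_continuous[OF S gc gb, folded \<phi>_def]
  note intf = set_integrable_bounded_piecewise_continuous[OF S fc fb, folded \<psi>_def]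
  have i\<phi>: "\<phi> integrable_on {0..t}" and i\<psi>: "\<psi> integrable_on {0..t}" if "t \<in> {0..b}" for t
    using set_borel_integral_eq_integral(1)[OF intg] set_borel_integral_eq_integral(1)[OF intf] that
    by (auto intro: integrable_on_subinterval)
  define G where "G t = integral {0..t} \<phi>" for t
  define F where "F t = integral {0..t} \<psi>" for t
  have q: "q_signal g x u t s = G t - G s" if "t \<in> {0..b}" "s \<in> {0..b}" for t s
    unfolding q_signal_def G_def
    using interval_integral_eq_diff_integral[OF intg] that by (simp add: \<phi>_def[abs_def])
  \<comment> \<open>The integrated plant equation. The derivative of \<open>x\<close> is given only
    off \<open>S\<close>, hence the fundamental theorem with a finite exceptional set.\<close>
  have x_eq: "x t - x 0 = F t + G t *v \<theta>" if t: "t \<in> {0..b}" for t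
  proof -
    have "((\<lambda>r. \<psi> r + \<phi> r *v \<theta>) has_integral (x t - x 0)) {0..t}"
      using t
      by (intro fundamental_theorem_of_calculus_interior_strong[OF S])
         (auto simp: ode \<phi>_def \<psi>_def plant_def[symmetric] intro: continuous_on_subset[OF x])
    moreover have "((\<lambda>r. \<psi> r + \<phi> r *v \<theta>) has_integral (F t + G t *v \<theta>)) {0..t}"
      unfolding F_def G_def
      using has_integral_linear[OF integrable_integral[OF i\<phi>[OF t]] bounded_linear_matrix_vector_mult_left[of \<theta>]]
        integrable_integral[OF i\<psi>[OF t]]
      by (intro has_integral_add) (simp_all add: o_def)
    ultimately show ?thesis by (rule has_integral_unique)
  qed
  have p: "p_signal f x u t s = (G t - G s) *v \<theta>" if "t \<in> {0..b}" "s \<in> {0..b}" for t s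
  proof -
    have "p_signal f x u t s = (x t - x 0) - (x s - x 0) - (F t - F s)"
      unfolding p_signal_def F_def
      using interval_integral_eq_diff_integral[OF intf, of s t] that by (simp add: \<psi>_def[abs_def])
    also have "\<dots> = G t *v \<theta> - G s *v \<theta>"
      unfolding x_eq[OF that(1)] x_eq[OF that(2)] by simp
    finally show ?thesis
      by (simp add: matrix_vector_mult_diff_rdistrib)
  qed
  have G_cont: "continuous_on {0..b} G"
    unfolding G_def using i\<phi>[of b] b by (intro indefinite_integral_continuous_1) auto
  define K where "K t s = transpose (G t - G s) ** (G t - G s)" for t s
  have K_cont: "continuous_on ({0..b} \<times> {0..b}) (\<lambda>(t, s). K t s)"
    unfolding K_def case_prod_beta
    by (intro continuous_intros continuous_on_compose2[OF G_cont]) auto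
  define Q where "Q = integral {0..b} (\<lambda>t. integral {0..b} (K t))"
  have Kint: "K t integrable_on {0..b}" if "t \<in> {0..b}" for t
    by (rule integrable_continuous_real[OF continuous_on_section[OF K_cont that]])
  have KKint: "(\<lambda>t. integral {0..b} (K t)) integrable_on {0..b}"
    using integral_continuous_on_param[of "{0..b}" 0 b K] K_cont
    by (auto intro: integrable_continuous_real)
  \<comment> \<open>Used for the action of the Gram matrix on \<open>\<theta>\<close>, for its
    action on a vector \<open>v\<close>, and for its quadratic form.\<close>
  have lin: "integral {0..b} (\<lambda>t. integral {0..b} (\<lambda>s. h (K t s))) = h Q"
    if h: "bounded_linear h" for h :: "real^'l^'l \<Rightarrow> 'z::euclidean_space"
  proof -
    have "integral {0..b} (\<lambda>t. integral {0..b} (\<lambda>s. h (K t s))) = integral {0..b} (\<lambda>t. h (integral {0..b} (K t)))"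
      by (rule integral_cong) (use integral_linear[OF Kint h] in \<open>simp add: o_def\<close>)
    also have "\<dots> = h Q"
      using integral_linear[OF KKint h] by (simp add: o_def Q_def)
    finally show ?thesis .
  qed
  have Q_eq: "(LBINT t=ereal 0..ereal b. (LBINT s=ereal 0..ereal b.
           transpose (q_signal g x u t s) ** q_signal g x u t s)) = Q"
    unfolding Q_def
    by (rule interval_integral_interval_integral_continuous) (use b K_cont q in \<open>auto simp: K_def\<close>)
  have P_eq: "(LBINT t=ereal 0..ereal b. (LBINT s=ereal 0..ereal b.
           transpose (q_signal g x u t s) *v p_signal f x u t s)) = Q *v \<theta>"
    unfolding lin[OF bounded_linear_matrix_vector_mult_left[of \<theta>], symmetric]
    by (rule interval_integral_interval_integral_continuous)
       (use b K_cont q p in \<open>auto simp: K_def matrix_vector_mul_assoc case_prod_beta intro!: continuous_intros\<close>)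
  have ker: "Q *v v = 0 \<longleftrightarrow> (\<forall>r\<in>{0..<b}. \<phi> r *v v = 0)" for v
  proof
    assume "Q *v v = 0"
    have bl: "bounded_linear (\<lambda>A. v \<bullet> ((A :: real^'l^'l) *v v))"
      using bounded_linear_compose[OF bounded_linear_inner_right bounded_linear_matrix_vector_mult_left] .
    \<comment> \<open>The quadratic form of \<open>Q\<close> is a double integral of a continuous
      nonnegative function, so it vanishes only if that function vanishes on the whole
      square.\<close>
    have "integral {0..b} (\<lambda>t. integral {0..b} (\<lambda>s. (norm ((G t - G s) *v v))\<^sup>2)) = v \<bullet> (Q *v v)"
      unfolding lin[OF bl, symmetric] by (simp add: K_def inner_transpose_mult_self)
    then have "integral {0..b} (\<lambda>t. integral {0..b} (\<lambda>s. (norm ((G t - G s) *v v))\<^sup>2)) = 0"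
      using \<open>Q *v v = 0\<close> by simp
    moreover have "continuous_on ({0..b} \<times> {0..b}) (\<lambda>(t, s). (norm ((G t - G s) *v v))\<^sup>2)"
      unfolding case_prod_beta
      by (intro continuous_intros continuous_on_compose2[OF G_cont]) auto
    ultimately have GG: "\<forall>t\<in>{0..b}. \<forall>s\<in>{0..b}. (norm ((G t - G s) *v v))\<^sup>2 = 0"
      using integral_integral_eq_0_iff[OF b, of "\<lambda>t s. (norm ((G t - G s) *v v))\<^sup>2"] by simp
    \<comment> \<open>The primitive vanishes at 0, so \<open>s = 0\<close> turns the statement on
      differences into one on \<open>G t\<close>.\<close>
    have Gv: "G t *v v = 0" if "t \<in> {0..b}" for t
    proof -
      have "(norm ((G t - G 0) *v v))\<^sup>2 = 0"
        using GG b that by (meson atLeastAtMost_iff less_imp_le order_refl)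
      then show ?thesis by (simp add: G_def)
    qed
    show "\<forall>r\<in>{0..<b}. \<phi> r *v v = 0"
    proof
      fix r assume r: "r \<in> {0..<b}"
      have int: "(\<lambda>r. \<phi> r *v v) integrable_on {r..b}"
      proof -
        have "\<phi> integrable_on {r..b}"
          using i\<phi>[of b] b r by (auto intro: integrable_on_subinterval)
        from integrable_linear[OF this bounded_linear_matrix_vector_mult_left[of v]]
        show ?thesis by (simp add: o_def)
      qed
      have zero: "integral {r..t} (\<lambda>r. \<phi> r *v v) = 0" if t: "t \<in> {r..b}" for t
      proof -
        have "integral {r..t} (\<lambda>r. \<phi> r *v v) = integral {r..t} \<phi> *v v"
          using integral_linear[OF _ bounded_linear_matrix_vector_mult_left[of v], of \<phi> "{r..t}"]
            integrable_on_subinterval[OF i\<phi>[of b], of r t] b r t by (simp add: o_def)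
        also have "integral {r..t} \<phi> = G t - G r"
          using Henstock_Kurzweil_Integration.integral_combine[of 0 r t \<phi>] i\<phi>[of t] r t
          by (simp add: G_def algebra_simps)
        finally show ?thesis using Gv r t by (simp add: matrix_vector_mult_diff_rdistrib)
      qed
      \<comment> \<open>Right continuity lets the vanishing integral over \<open>{r..t}\<close> be
        differentiated from the right at every \<open>r < b\<close>, points of \<open>S\<close>
        included, so the pointwise statement has no exceptional set.\<close>
      have "continuous (at_right r) (\<lambda>r. \<phi> r *v v)"
        unfolding \<phi>_def
        by (rule bounded_linear.continuous[OF bounded_linear_matrix_vector_mult_left gr[OF r]])
      then have "continuous (at r within {r..b}) (\<lambda>r. \<phi> r *v v)"
        using r by (simp add: at_within_Icc_at_right)
      from integral_has_vector_derivative_continuous_at[OF int, of r "{}"] this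
      have "((\<lambda>t. integral {r..t} (\<lambda>r. \<phi> r *v v)) has_vector_derivative \<phi> r *v v) (at r within {r..b})"
        using r by simp
      then have 1: "((\<lambda>t. 0) has_vector_derivative \<phi> r *v v) (at r within {r..b})"
        by (rule has_vector_derivative_transform[rotated 2]) (use zero r in auto)
      have 2: "((\<lambda>t. 0 :: real^'n) has_vector_derivative 0) (at r within {r..b})"
        by simp
      show "\<phi> r *v v = 0"
        by (rule vector_derivative_unique_within[OF _ 1 2]) (use r in \<open>auto simp: at_within_Icc_at_right\<close>)
    qed
  next
    assume v: "\<forall>r\<in>{0..<b}. \<phi> r *v v = 0"
    have Gv: "G t *v v = 0" if t: "t \<in> {0..b}" for t
    proof -
      have "G t *v v = integral {0..t} (\<lambda>r. \<phi> r *v v)"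
        unfolding G_def
        using integral_linear[OF i\<phi>[OF t] bounded_linear_matrix_vector_mult_left[of v]] by (simp add: o_def)
      \<comment> \<open>The kernel condition says nothing at \<open>b\<close>, but a single point
        does not change the integral.\<close>
      also have "\<dots> = integral {0..t} (\<lambda>r. 0)"
        by (rule integral_spike[of "{b}"]) (use v t in auto)
      finally show ?thesis by simp
    qed
    have "Q *v v = integral {0..b} (\<lambda>t. integral {0..b} (\<lambda>s. K t s *v v))"
      by (rule lin[OF bounded_linear_matrix_vector_mult_left, symmetric])
    also have "\<dots> = integral {0..b} (\<lambda>t. integral {0..b} (\<lambda>s. 0))"
      by (intro integral_cong)
         (simp add: K_def matrix_vector_mul_assoc[symmetric] matrix_vector_mult_diff_rdistrib Gv)
    finally show "Q *v v = 0" by simp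
  qed
  have "Q *v \<theta> = Q *v \<eta> \<longleftrightarrow> Q *v (\<eta> - \<theta>) = 0" for \<eta>
    by (auto simp: matrix_vector_mult_diff_distrib)
  then show ?thesis
    unfolding least_squares_set_def P_eq Q_eq ker[unfolded \<phi>_def, symmetric] by simp
qed

text \<open>Interval integrals ignore end points. Hence the estimate chosen at time
  \<open>b\<close>, which enters the input at \<open>b\<close>, has no influence on the constraint
  that determines it.\<close>

lemma least_squares_set_cong:
  assumes b: "b > 0" and x: "\<And>t. t \<in> {0<..<b} \<Longrightarrow> x' t = x t" and u: "\<And>t. t \<in> {0<..<b} \<Longrightarrow> u' t = u t"
  shows "least_squares_set \<Theta> f g x' u' b = least_squares_set \<Theta> f g x u b"
proof -
  have "p_signal f x' u' t s = p_signal f x u t s" "q_signal g x' u' t s = q_signal g x u t s"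
    if "t \<in> {0<..<b}" "s \<in> {0<..<b}" for t s
  proof -
    have "r \<in> {0<..<b}" if "r \<in> einterval (min (ereal s) (ereal t)) (max (ereal s) (ereal t))" for r
      using that \<open>t \<in> _\<close> \<open>s \<in> _\<close>
      by (auto simp: einterval_def min_def max_def split: if_splits)
    then show "p_signal f x' u' t s = p_signal f x u t s" "q_signal g x' u' t s = q_signal g x u t s"
      unfolding p_signal_def q_signal_def using that
      by (auto simp: x u intro!: arg_cong2[where f = "(-)"] interval_integral_cong)
  qed
  then have "(LBINT t=ereal 0..ereal b. (LBINT s=ereal 0..ereal b.
           transpose (q_signal g x' u' t s) *v p_signal f x' u' t s))
      = (LBINT t=ereal 0..ereal b. (LBINT s=ereal 0..ereal b.
           transpose (q_signal g x u t s) *v p_signal f x u t s))"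
    and "(LBINT t=ereal 0..ereal b. (LBINT s=ereal 0..ereal b.
           transpose (q_signal g x' u' t s) ** q_signal g x' u' t s))
      = (LBINT t=ereal 0..ereal b. (LBINT s=ereal 0..ereal b.
           transpose (q_signal g x u t s) ** q_signal g x u t s))"
    using b by (auto simp: einterval_def min_def max_def intro!: interval_integral_cong)
  then show ?thesis
    unfolding least_squares_set_def by simp
qed

section \<open>One interval between events\<close>

locale adaptive_loop =
  fixes \<Theta> :: "(real^'l) set"
    and f :: "real^'n \<Rightarrow> real^'m \<Rightarrow> real^'n"
    and g :: "real^'n \<Rightarrow> real^'m \<Rightarrow> real^'l^'n"
    and k :: "real^'l \<Rightarrow> real^'n \<Rightarrow> real^'m"
    and V :: "real^'l \<Rightarrow> real^'n \<Rightarrow> real"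
    and a :: "real^'n \<Rightarrow> real"
    and \<sigma> T :: real
    and \<theta> :: "real^'l"
  assumes closed_Theta: "closed \<Theta>" and convex_Theta: "convex \<Theta>" and theta: "\<theta> \<in> \<Theta>"
    and f_smooth: "smooth_on (\<lambda>(x, u). f x u) UNIV" and f_0: "f 0 0 = 0"
    and g_smooth: "smooth_on (\<lambda>(x, u). g x u) UNIV" and g_0: "g 0 0 = 0"
    and k_smooth: "smooth_on (\<lambda>(\<theta>, x). k \<theta> x) (\<Theta> \<times> UNIV)" and k_0: "\<And>\<eta>. \<eta> \<in> \<Theta> \<Longrightarrow> k \<eta> 0 = 0"
    and sigma: "\<sigma> > 0"
    and V_C1: "\<And>\<eta>. \<eta> \<in> \<Theta> \<Longrightarrow> continuously_differentiable (V \<eta>)"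
    and V_pos: "\<And>\<eta>. \<eta> \<in> \<Theta> \<Longrightarrow> positive_definite (V \<eta>)"
    and V_rad: "\<And>\<eta>. \<eta> \<in> \<Theta> \<Longrightarrow> radially_unbounded (V \<eta>)"
    and V_decay: "\<And>\<eta> x. \<eta> \<in> \<Theta> \<Longrightarrow>
          grad (V \<eta>) x \<bullet> plant f g \<eta> x (k \<eta> x) \<le> - 2 * \<sigma> * V \<eta> x"
    and T: "T > 0"
    and a_pos: "positive_definite a"
begin

abbreviation closed_loop :: "real^'l \<Rightarrow> real^'n \<Rightarrow> real^'n" where
  "closed_loop \<eta> z \<equiv> plant f g \<theta> z (k \<eta> z)"

lemma V_ge_0: "\<eta> \<in> \<Theta> \<Longrightarrow> V \<eta> z \<ge> 0"
  using V_pos[of \<eta>] unfolding positive_definite_def by (metis less_imp_le order_refl)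

lemma lipschitz_k:
  assumes "\<eta> \<in> \<Theta>" "compact K"
  obtains L where "L-lipschitz_on K (k \<eta>)"
proof -
  have "compact (Pair \<eta> ` K)"
    using assms(2) by (intro compact_continuous_image continuous_intros)
  then obtain L where "L-lipschitz_on (Pair \<eta> ` K) (\<lambda>(\<theta>, x). k \<theta> x)"
    using smooth_on_imp_lipschitz_on_compact[OF k_smooth] assms(1) by blast
  moreover have "1-lipschitz_on K (Pair \<eta>)"
    by (auto simp: lipschitz_on_def dist_Pair_Pair)
  ultimately have "(L * 1)-lipschitz_on K (\<lambda>x. case Pair \<eta> x of (\<theta>, x) \<Rightarrow> k \<theta> x)"
    by (rule lipschitz_on_compose2[rotated])
  then show thesis using that by simp
qed

lemma lipschitz_closed_loop:
  assumes eta: "\<eta> \<in> \<Theta>" and K: "compact K"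
  shows "\<exists>L. L-lipschitz_on K (closed_loop \<eta>)"
proof -
  obtain Lk where Lk: "Lk-lipschitz_on K (k \<eta>)"
    using lipschitz_k[OF assms] .
  define P where "P z = (z, k \<eta> z)" for z
  obtain LP where P: "LP-lipschitz_on K P"
    unfolding P_def using lipschitz_on_Pair[OF lipschitz_on_id Lk] by blast
  have PK: "compact (P ` K)"
    using K P by (intro compact_continuous_image lipschitz_on_continuous_on)
  obtain Lf where "Lf-lipschitz_on (P ` K) (\<lambda>(x, u). f x u)"
    using smooth_on_imp_lipschitz_on_compact[OF f_smooth PK] by blast
  then have f: "(Lf * LP)-lipschitz_on K (\<lambda>z. f z (k \<eta> z))"
    using lipschitz_on_compose2[OF P, of Lf "\<lambda>(x, u). f x u"] by (simp add: P_def)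
  obtain Lg where "Lg-lipschitz_on (P ` K) (\<lambda>(x, u). g x u)"
    using smooth_on_imp_lipschitz_on_compact[OF g_smooth PK] by blast
  then have g: "(Lg * LP)-lipschitz_on K (\<lambda>z. g z (k \<eta> z))"
    using lipschitz_on_compose2[OF P, of Lg "\<lambda>(x, u). g x u"] by (simp add: P_def)
  obtain B where "B-lipschitz_on ((\<lambda>z. g z (k \<eta> z)) ` K) (\<lambda>A. A *v \<theta>)"
    using bounded_linear.lipschitz_boundE[OF bounded_linear_matrix_vector_mult_left] .
  from lipschitz_on_compose2[OF g this] f
  show ?thesis
    unfolding plant_def using lipschitz_on_add by blast
qed

lemma continuous_on_k: "\<eta> \<in> \<Theta> \<Longrightarrow> continuous_on A (k \<eta>)"
proof -
  assume eta: "\<eta> \<in> \<Theta>"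
  have "isCont (k \<eta>) z" for z
  proof -
    obtain L where "L-lipschitz_on (cball z 1) (k \<eta>)"
      using lipschitz_k[OF eta compact_cball] .
    then have "continuous_on (ball z 1) (k \<eta>)"
      using lipschitz_on_continuous_on continuous_on_subset ball_subset_cball by blast
    then show ?thesis
      by (simp add: continuous_on_eq_continuous_at)
  qed
  then show ?thesis by (simp add: continuous_at_imp_continuous_on)
qed

lemma continuous_on_V: "\<eta> \<in> \<Theta> \<Longrightarrow> continuous_on A (V \<eta>)"
  using continuously_differentiable_imp_continuous_on V_C1 by blast

text \<open>An interval between events in local time \<open>{0..d}\<close>. The dynamics are
  autonomous, so the trigger equation is required for all starting times \<open>s\<close>, and one
  choice of \<open>y\<close> and \<open>d\<close> serves wherever the interval is placed.\<close>

definition event_step :: "real^'l \<Rightarrow> real^'n \<Rightarrow> (real \<Rightarrow> real^'n) \<Rightarrow> real \<Rightarrow> bool" where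
  "event_step \<eta> \<xi> y d \<longleftrightarrow> 0 < d \<and> d \<le> T \<and> y 0 = \<xi> \<and> ode_solution (closed_loop \<eta>) {0..d} y \<and>
     (\<forall>s. ereal (s + d) = min (ereal (s + T)) (trigger_time f g k V a T \<theta> \<eta> s \<xi>)) \<and>
     (\<forall>t\<in>{0..d}. V \<eta> (y t) \<le> V \<eta> \<xi> + a \<xi>) \<and>
     (d = T \<or> \<xi> \<noteq> 0 \<and> V \<eta> (y d) = V \<eta> \<xi> + a \<xi>)"

text \<open>The trajectory stays in the compact sublevel set of \<open>V \<eta>\<close> until it reaches the trigger level, so
  the vector field may be replaced by its bounded, globally Lipschitz composition with the projection
  onto a ball containing this set.\<close>

lemma truncated_solution:
  assumes eta: "\<eta> \<in> \<Theta>" and c: "c > 0"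
  obtains y where "y 0 = \<xi>" "continuous_on {0..} y"
    "\<And>t. (\<forall>s\<in>{0..t}. V \<eta> (y s) \<le> c) \<Longrightarrow> ode_solution (closed_loop \<eta>) {0..t} y"
proof -
  have "compact {x. V \<eta> x \<le> c}"
    using V_rad[OF eta] c unfolding radially_unbounded_def by blast
  then obtain R where R: "R > 0" "\<forall>x\<in>{x. V \<eta> x \<le> c}. norm x \<le> R"
    using compact_imp_bounded bounded_pos by metis
  define C where "C = cball (0 :: real^'n) R"
  have C: "closed C" "convex C" "C \<noteq> {}" "compact C"
    using R(1) by (auto simp: C_def)
  define F where "F z = closed_loop \<eta> (closest_point C z)" for z
  obtain L where L: "L-lipschitz_on C (closed_loop \<eta>)"
    using lipschitz_closed_loop[OF eta C(4)] by blast
  have cp: "1-lipschitz_on UNIV (closest_point C)"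
    using closest_point_lipschitz[OF C(2,1,3)] by (auto simp: lipschitz_on_def)
  have "range (closest_point C) \<subseteq> C"
    using closest_point_in_set[OF C(1,3)] by blast
  then have F_lip: "(L * 1)-lipschitz_on UNIV F"
    unfolding F_def by (intro lipschitz_on_compose2[OF cp] lipschitz_on_subset[OF L])
  have "bounded (closed_loop \<eta> ` C)"
    using lipschitz_on_continuous_on[OF L] C(4) compact_continuous_image compact_imp_bounded by blast
  then obtain B where "\<forall>z\<in>C. norm (closed_loop \<eta> z) \<le> B"
    by (auto simp: bounded_iff)
  then have "norm (F z) \<le> B" for z
    unfolding F_def using closest_point_in_set[OF C(1,3)] by blast
  then obtain y where y: "y 0 = \<xi>" "ode_solution F {0..} y"
    using ode_solution_exists_bounded_lipschitz[OF F_lip] by blast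
  show thesis
  proof
    show "y 0 = \<xi>" by fact
    show "continuous_on {0..} y"
      using y(2) by (rule ode_solution_continuous_on)
    fix t assume t: "\<forall>s\<in>{0..t}. V \<eta> (y s) \<le> c"
    show "ode_solution (closed_loop \<eta>) {0..t} y"
    proof (rule ode_solution_cong)
      show "ode_solution F {0..t} y"
        using y(2) by (rule ode_solution_subset) auto
      show "closed_loop \<eta> (y s) = F (y s)" if "s \<in> {0..t}" for s
      proof -
        have "y s \<in> C" using t that R(2) by (auto simp: C_def)
        then show ?thesis by (simp add: F_def closest_point_self)
      qed
    qed simp
  qed
qed

text \<open>\<open>hit_times\<close> quantifies over trajectories of its own; by uniqueness each of
  them is the shifted \<open>y\<close>, so hits can be read off the one trajectory at hand.\<close>

lemma hit_timesD:
  assumes eta: "\<eta> \<in> \<Theta>" and y: "y 0 = \<xi>" "ode_solution (closed_loop \<eta>) {0..d} y"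
    and r: "r \<in> hit_times f g k V a \<theta> \<eta> s \<xi>" "r \<le> s + d"
  shows "V \<eta> (y (r - s)) = V \<eta> \<xi> + a \<xi>" "s < r"
proof -
  obtain y' where y': "s < r" "y' s = \<xi>" "ode_solution (closed_loop \<eta>) {s..r} y'"
      "V \<eta> (y' r) = V \<eta> \<xi> + a \<xi>"
    using r(1) unfolding hit_times_def by blast
  have "ode_solution (closed_loop \<eta>) {s..r} (\<lambda>t. y (t - s))"
    by (rule ode_solution_shift, rule ode_solution_subset[OF y(2)]) (use r(2) in auto)
  then have "y' r = y (r - s)"
    using ode_solution_unique[OF lipschitz_closed_loop[OF eta] y'(3), of "\<lambda>t. y (t - s)" r] y y' by auto
  with y' show "V \<eta> (y (r - s)) = V \<eta> \<xi> + a \<xi>" "s < r" by auto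
qed

lemma event_step_exists:
  assumes eta: "\<eta> \<in> \<Theta>"
  obtains y d where "event_step \<eta> \<xi> y d"
proof (cases "\<xi> = 0")
  case True
  \<comment> \<open>The origin is an equilibrium for every estimate, and there the trigger time is
    \<open>s + T\<close> by definition.\<close>
  have "closed_loop \<eta> 0 = 0"
    using f_0 g_0 k_0[OF eta] by (simp add: plant_def)
  moreover have "a 0 = 0"
    using a_pos by (simp add: positive_definite_def)
  ultimately have "event_step \<eta> \<xi> (\<lambda>_. 0) T"
    using T True by (auto simp: event_step_def ode_solution_def trigger_time_def)
  then show thesis by (rule that)
next
  case False
  define c where "c = V \<eta> \<xi> + a \<xi>"
  have a: "a \<xi> > 0" using a_pos False by (auto simp: positive_definite_def)
  have c: "V \<eta> \<xi> < c" "c > 0"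
    using a V_ge_0[OF eta, of \<xi>] by (auto simp: c_def)
  obtain y where y: "y 0 = \<xi>" "continuous_on {0..} y"
    and sol: "\<And>t. (\<forall>s\<in>{0..t}. V \<eta> (y s) \<le> c) \<Longrightarrow> ode_solution (closed_loop \<eta>) {0..t} y"
    using truncated_solution[OF eta c(2)] by metis
  have W_cont: "continuous_on A (\<lambda>t. V \<eta> (y t))" if "A \<subseteq> {0..}" for A
    by (rule continuous_on_compose2[OF continuous_on_V[OF eta, of UNIV] continuous_on_subset[OF y(2) that]]) simp
  \<comment> \<open>Positivity of \<open>a \<xi>\<close> puts the start strictly below the level
    \<open>c\<close>, so exceeding it would require a crossing.\<close>
  have below: "V \<eta> (y t) < c" if "t \<ge> 0" "\<forall>s\<in>{0..t}. V \<eta> (y s) \<noteq> c" for t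
  proof (rule ccontr)
    assume "\<not> V \<eta> (y t) < c"
    then obtain s where "0 \<le> s" "s \<le> t" "V \<eta> (y s) = c"
      using IVT'[of "\<lambda>t. V \<eta> (y t)" 0 c t] c(1) y(1) \<open>t \<ge> 0\<close> W_cont[of "{0..t}"] by auto
    then show False using that(2) by auto
  qed
  \<comment> \<open>The hits of the trigger level up to time \<open>T\<close>. This set is closed,
    so a first hit \<open>d\<close> exists when it is nonempty; it is positive because the start
    lies below \<open>c\<close>.\<close>
  define Z where "Z = {t\<in>{0..T}. V \<eta> (y t) = c}"
  define d where "d = (if Z = {} then T else Inf Z)"
  have bdd: "bdd_below Z" unfolding Z_def by (intro bdd_belowI[of _ 0]) auto
  have "closed Z"
    unfolding Z_def using continuous_closed_preimage_constant[OF W_cont[of "{0..T}"], of c] by auto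
  then have dZ: "d \<in> Z" if "Z \<noteq> {}"
    using that bdd closed_contains_Inf by (auto simp: d_def)
  have ne: "0 \<le> d" "d \<le> T" "V \<eta> (y d) = c" if "Z \<noteq> {}"
    using dZ[OF that] by (simp_all add: Z_def)
  have empty: "d = T" if "Z = {}"
    using that by (simp add: d_def)
  have d: "0 < d" "d \<le> T"
  proof -
    show "d \<le> T" using ne(2) empty by (cases "Z = {}") simp_all
    show "0 < d"
    proof (cases "Z = {}")
      case False
      have "d \<noteq> 0" using ne(3)[OF False] c(1) y(1) by auto
      with ne(1)[OF False] show ?thesis by simp
    qed (use empty T in simp)
  qed
  have notZ: "t \<notin> Z" if "t < d" for t
  proof
    assume "t \<in> Z"
    then have "d \<le> t" using bdd cInf_lower by (auto simp: d_def)
    with that show False by simp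
  qed
  have less: "V \<eta> (y t) < c" if "0 \<le> t" "t < d" for t
  proof (rule below[OF that(1)], rule ballI)
    fix s assume "s \<in> {0..t}"
    then show "V \<eta> (y s) \<noteq> c" using notZ[of s] that d(2) by (auto simp: Z_def)
  qed
  note dc = ne(3)
  have lessT: "V \<eta> (y d) < c" "d = T" if "Z = {}"
  proof -
    show "d = T" by (rule empty[OF that])
    show "V \<eta> (y d) < c"
      using that T unfolding \<open>d = T\<close> by (intro below) (auto simp: Z_def)
  qed
  have le: "V \<eta> (y t) \<le> c" if "t \<in> {0..d}" for t
    using less[of t] dc lessT that by (cases "t = d"; cases "Z = {}") auto
  have sold: "ode_solution (closed_loop \<eta>) {0..d} y"
    using sol le by blast
  have hit: "d \<le> r - s" and hit': "Z \<noteq> {} \<or> d < r - s" if "r \<in> hit_times f g k V a \<theta> \<eta> s \<xi>" for r s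
  proof -
    have "V \<eta> (y (r - s)) = c" "s < r" if "r \<le> s + d"
      using hit_timesD[OF eta y(1) sold \<open>r \<in> _\<close> that] by (auto simp: c_def)
    then show "d \<le> r - s" "Z \<noteq> {} \<or> d < r - s"
      using less[of "r - s"] lessT(1) by (smt (verit))+
  qed
  have "ereal (s + d) = min (ereal (s + T)) (trigger_time f g k V a T \<theta> \<eta> s \<xi>)" for s
  proof (cases "Z = {}")
    case True
    \<comment> \<open>With no hit up to \<open>T\<close>, all elements of \<open>hit_times\<close>
      lie after \<open>s + T\<close>; if there are none, the infimum is infinite and the minimum is
      still \<open>s + T\<close>.\<close>
    then have "ereal (s + T) \<le> Inf (ereal ` hit_times f g k V a \<theta> \<eta> s \<xi>)"
      using hit[of _ s] lessT(2) by (intro Inf_greatest) force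
    then show ?thesis
      using False lessT(2)[OF True] by (simp add: trigger_time_def)
  next
    case nonempty: False
    have "ode_solution (closed_loop \<eta>) {s..s + d} (\<lambda>t. y (t - s))"
      by (rule ode_solution_shift, rule ode_solution_subset[OF sold]) auto
    then have "s + d \<in> hit_times f g k V a \<theta> \<eta> s \<xi>"
      unfolding hit_times_def using d(1) y(1) dc[OF nonempty]
      by (auto simp: c_def intro!: exI[of _ "\<lambda>t. y (t - s)"])
    then have "Inf (ereal ` hit_times f g k V a \<theta> \<eta> s \<xi>) = ereal (s + d)"
      using hit[of _ s] by (intro antisym Inf_lower Inf_greatest) force+
    then show ?thesis
      using False d(2) by (simp add: trigger_time_def)
  qed
  then have "event_step \<eta> \<xi> y d"
    unfolding event_step_def
    using d y(1) sold le dc lessT(2) False by (auto simp: c_def)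
  then show thesis by (rule that)
qed

section \<open>Uniqueness of hybrid solutions\<close>

lemma hybrid_solution_unique:
  assumes h: "hybrid_solution \<Theta> f g k V a T \<theta> x h \<tau>" and h': "hybrid_solution \<Theta> f g k V a T \<theta> x' h' \<tau>'"
    and init: "x' 0 = x 0" "h' 0 = h 0"
  shows "\<tau>' = \<tau>" "t \<in> solution_domain \<tau> \<Longrightarrow> x' t = x t \<and> h' t = h t"
proof -
  have \<tau>_ge: "\<tau> j \<ge> 0" for j
  proof (induction j)
    case 0
    then show ?case using h by (simp add: hybrid_solution_def)
  next
    case (Suc j)
    have "\<tau> j < \<tau> (Suc j)" using h by (simp add: hybrid_solution_def)
    with Suc show ?case by simp
  qed
  \<comment> \<open>Induction over events: the data at an event fix the next event time, uniqueness
    for the differential equation fixes the state up to it, and the past then fixes the next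
    estimate.\<close>
  have agree: "\<tau>' i = \<tau> i \<and> h' (\<tau> i) = h (\<tau> i) \<and> x' (\<tau> i) = x (\<tau> i) \<and>
      (\<forall>t\<in>{0..<\<tau> i}. x' t = x t \<and> h' t = h t)" for i
  proof (induction i)
    case 0
    then show ?case
      using h h' init by (simp add: hybrid_solution_def)
  next
    case (Suc i)
    have less: "\<tau> j < \<tau> (Suc j)" "\<tau>' j < \<tau>' (Suc j)" for j
      using h h' by (simp_all add: hybrid_solution_def)
    have "ereal (\<tau>' (Suc i)) = ereal (\<tau> (Suc i))"
      using h h' Suc unfolding hybrid_solution_def by metis
    then have \<tau>: "\<tau>' (Suc i) = \<tau> (Suc i)" by simp
    have eta: "h (\<tau> i) \<in> \<Theta>"
    proof -
      have "\<tau> i \<in> solution_domain \<tau>"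
        using less(1)[of i] by (auto simp: solution_domain_def intro!: exI[of _ i])
      then show ?thesis using h by (simp add: hybrid_solution_def)
    qed
    have ode: "ode_solution (closed_loop (h (\<tau> i))) {\<tau> i..<\<tau> (Suc i)} x"
      using h by (simp add: hybrid_solution_def)
    have ode': "ode_solution (closed_loop (h (\<tau> i))) {\<tau> i..<\<tau> (Suc i)} x'"
      using h' Suc \<tau> unfolding hybrid_solution_def by metis
    \<comment> \<open>Uniqueness is stated on closed intervals, so it is applied to
      \<open>{\<tau> i..t}\<close> for each \<open>t\<close> before the next event.\<close>
    have xeq: "x' t = x t" if "t \<in> {\<tau> i..<\<tau> (Suc i)}" for t
      by (rule ode_solution_unique[OF lipschitz_closed_loop[OF eta], of "\<tau> i" t])
         (use that Suc in \<open>auto intro: ode_solution_subset[OF ode] ode_solution_subset[OF ode']\<close>)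
    have heq: "h' t = h t" if "t \<in> {\<tau> i..<\<tau> (Suc i)}" for t
    proof -
      have "h t = h (\<tau> i)" using h that unfolding hybrid_solution_def by blast
      moreover have "h' t = h' (\<tau>' i)" using h' that Suc \<tau> unfolding hybrid_solution_def by metis
      ultimately show ?thesis using Suc by simp
    qed
    have before: "x' t = x t \<and> h' t = h t" if "t \<in> {0..<\<tau> (Suc i)}" for t
      using Suc xeq[of t] heq[of t] that by (cases "t < \<tau> i") auto
    \<comment> \<open>The right end belongs to the following interval, so both states are continuous
      up to the event and their agreement extends to it.\<close>
    have Icc: "{\<tau>'' i..\<tau>'' (Suc i)} \<subseteq> solution_domain \<tau>''"
      if "\<And>j. \<tau>'' j < \<tau>'' (Suc j)" for \<tau>'' :: "nat \<Rightarrow> real"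
    proof
      fix t assume "t \<in> {\<tau>'' i..\<tau>'' (Suc i)}"
      then have "t \<in> {\<tau>'' i..<\<tau>'' (Suc i)} \<or> t \<in> {\<tau>'' (Suc i)..<\<tau>'' (Suc (Suc i))}"
        using that[of "Suc i"] by auto
      then show "t \<in> solution_domain \<tau>''" unfolding solution_domain_def by blast
    qed
    have "continuous_on {\<tau> i..\<tau> (Suc i)} x"
      using h Icc[of \<tau>] less(1) unfolding hybrid_solution_def by (blast intro: continuous_on_subset)
    moreover have "continuous_on {\<tau>' i..\<tau>' (Suc i)} x'"
      using h' Icc[of \<tau>'] less(2) unfolding hybrid_solution_def by (blast intro: continuous_on_subset)
    ultimately have "continuous_on (closure {\<tau> i..<\<tau> (Suc i)}) (\<lambda>t. x' t - x t)"
      using Suc \<tau> less(1)[of i] by (auto intro: continuous_on_diff)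
    from continuous_constant_on_closure[OF this, of 0 "\<tau> (Suc i)"]
    have xSuc: "x' (\<tau> (Suc i)) = x (\<tau> (Suc i))"
      using xeq less(1)[of i] by auto
    have "least_squares_set \<Theta> f g x' (\<lambda>t. k (h' t) (x' t)) (\<tau> (Suc i)) =
        least_squares_set \<Theta> f g x (\<lambda>t. k (h t) (x t)) (\<tau> (Suc i))"
      using before \<tau>_ge[of i] less(1)[of i] by (intro least_squares_set_cong) auto
    moreover have "is_arg_min (\<lambda>\<zeta>. (norm (\<zeta> - h (\<tau> i)))\<^sup>2)
        (\<lambda>\<zeta>. \<zeta> \<in> least_squares_set \<Theta> f g x (\<lambda>t. k (h t) (x t)) (\<tau> (Suc i))) (h (\<tau> (Suc i)))"
      using h unfolding hybrid_solution_def by blast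
    moreover have "is_arg_min (\<lambda>\<zeta>. (norm (\<zeta> - h (\<tau> i)))\<^sup>2)
        (\<lambda>\<zeta>. \<zeta> \<in> least_squares_set \<Theta> f g x' (\<lambda>t. k (h' t) (x' t)) (\<tau> (Suc i))) \<eta> \<longleftrightarrow>
        \<eta> = h' (\<tau> (Suc i))" for \<eta>
    proof -
      have "is_arg_min (\<lambda>\<zeta>. (norm (\<zeta> - h' (\<tau>' i)))\<^sup>2)
          (\<lambda>\<zeta>. \<zeta> \<in> least_squares_set \<Theta> f g x' (\<lambda>t. k (h' t) (x' t)) (\<tau>' (Suc i))) \<eta> \<longleftrightarrow>
          \<eta> = h' (\<tau>' (Suc i))"
        using h' unfolding hybrid_solution_def by blast
      then show ?thesis using Suc \<tau> by simp
    qed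
    ultimately have "h (\<tau> (Suc i)) = h' (\<tau> (Suc i))"
      by simp
    with \<tau> xSuc before show ?case by simp
  qed
  then show "\<tau>' = \<tau>" by auto
  assume "t \<in> solution_domain \<tau>"
  then obtain i where "t \<in> {\<tau> i..<\<tau> (Suc i)}"
    unfolding solution_domain_def by blast
  then have "t \<in> {0..<\<tau> (Suc i)}"
    using \<tau>_ge[of i] by simp
  with agree[of "Suc i"] show "x' t = x t \<and> h' t = h t" by blast
qed

section \<open>The event recursion\<close>

definition event_sol :: "real^'l \<Rightarrow> real^'n \<Rightarrow> (real \<Rightarrow> real^'n) \<times> real" where
  "event_sol \<eta> \<xi> = (SOME (y, d). event_step \<eta> \<xi> y d)"

lemma event_sol: "\<eta> \<in> \<Theta> \<Longrightarrow> event_step \<eta> \<xi> (fst (event_sol \<eta> \<xi>)) (snd (event_sol \<eta> \<xi>))"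
  using event_step_exists[of \<eta> \<xi>] someI[of "\<lambda>(y, d). event_step \<eta> \<xi> y d"]
  unfolding event_sol_def by (metis (mono_tags, lifting) case_prod_unfold prod.collapse split_conv)

definition feasible :: "(real^'l) set \<Rightarrow> (real^'l) set" where
  "feasible N = {\<eta>\<in>\<Theta>. \<eta> - \<theta> \<in> N}"

lemma feasible:
  assumes N: "subspace N"
  shows "closed (feasible N)" "convex (feasible N)" "\<theta> \<in> feasible N"
proof -
  have *: "feasible N = \<Theta> \<inter> (+) \<theta> ` N"
    by (force simp: feasible_def image_iff)
  show "closed (feasible N)" "convex (feasible N)"
    unfolding * using N closed_Theta convex_Theta
    by (metis closed_Int closed_translation closed_subspace)
      (metis N convex_Theta convex_Int convex_translation subspace_imp_convex)
  show "\<theta> \<in> feasible N"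
    using theta subspace_0[OF N] by (simp add: feasible_def)
qed

end

text \<open>A state of the event recursion consists of the event time, the plant state, the estimate and
  the common kernel of the matrices \<open>g (x r) (u r)\<close> over the past.\<close>

locale adaptive_run = adaptive_loop \<Theta> f g k V a \<sigma> T \<theta>
  for \<Theta> :: "(real^'l) set"
    and f :: "real^'n \<Rightarrow> real^'m \<Rightarrow> real^'n"
    and g :: "real^'n \<Rightarrow> real^'m \<Rightarrow> real^'l^'n"
    and k V a \<sigma> T \<theta> +
  fixes x\<^sub>0 :: "real^'n" and \<eta>\<^sub>0 :: "real^'l"
  assumes eta0: "\<eta>\<^sub>0 \<in> \<Theta>"
begin

text \<open>The interval is half-open because at its right end the input already uses the next
  estimate.\<close>

definition next_kernel :: "real^'l \<Rightarrow> real^'n \<Rightarrow> (real^'l) set \<Rightarrow> (real^'l) set" where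
  "next_kernel \<eta> \<xi> N = (let (y, d) = event_sol \<eta> \<xi>
     in {v\<in>N. \<forall>r\<in>{0..<d}. g (y r) (k \<eta> (y r)) *v v = 0})"

text \<open>The initial kernel is the whole space, as no data are available at time 0. The update is
  a projection here; \<open>least_squares_set_state\<close> later identifies its target with the
  constraint set of the identifier.\<close>

primrec run :: "nat \<Rightarrow> real \<times> (real^'n) \<times> (real^'l) \<times> (real^'l) set" where
  "run 0 = (0, x\<^sub>0, \<eta>\<^sub>0, UNIV)"
| "run (Suc i) = (case run i of (t, \<xi>, \<eta>, N) \<Rightarrow>
     (t + snd (event_sol \<eta> \<xi>), fst (event_sol \<eta> \<xi>) (snd (event_sol \<eta> \<xi>)),
      closest_point (feasible (next_kernel \<eta> \<xi> N)) \<eta>, next_kernel \<eta> \<xi> N))"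

definition "time i = fst (run i)"
definition "pos i = fst (snd (run i))"
definition "est i = fst (snd (snd (run i)))"
definition "ker i = snd (snd (snd (run i)))"
definition "traj i = fst (event_sol (est i) (pos i))"
definition "dwell i = snd (event_sol (est i) (pos i))"

lemma run_0 [simp]: "time 0 = 0" "pos 0 = x\<^sub>0" "est 0 = \<eta>\<^sub>0" "ker 0 = UNIV"
  by (simp_all add: time_def pos_def est_def ker_def)

lemma run_Suc:
  "time (Suc i) = time i + dwell i"
  "pos (Suc i) = traj i (dwell i)"
  "est (Suc i) = closest_point (feasible (ker (Suc i))) (est i)"
  "ker (Suc i) = {v\<in>ker i. \<forall>r\<in>{0..<dwell i}. g (traj i r) (k (est i) (traj i r)) *v v = 0}"
  by (simp_all add: time_def pos_def est_def ker_def traj_def dwell_def next_kernel_def case_prod_beta)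

lemma subspace_ker: "subspace (ker i)"
proof (induction i)
  case (Suc i)
  then show ?case
    unfolding run_Suc(4) subspace_def
    by (auto simp: matrix_vector_right_distrib matrix_vector_mult_scaleR)
qed simp

lemma est_feasible: "est i \<in> feasible (ker i)"
proof (cases i)
  case 0
  then show ?thesis using eta0 by (simp add: feasible_def)
next
  case (Suc j)
  then show ?thesis
    using closest_point_in_set feasible[OF subspace_ker] by (metis empty_iff run_Suc(3))
qed

lemma est_in_Theta: "est i \<in> \<Theta>"
  using est_feasible by (simp add: feasible_def)

lemma est_minus_theta: "est i - \<theta> \<in> ker i"
  using est_feasible by (simp add: feasible_def)

lemma step: "event_step (est i) (pos i) (traj i) (dwell i)"
  unfolding traj_def dwell_def by (rule event_sol[OF est_in_Theta])

lemma step_simps: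
  shows dwell_pos: "0 < dwell i" and dwell_le: "dwell i \<le> T"
    and traj_0: "traj i 0 = pos i"
    and traj_ode: "ode_solution (closed_loop (est i)) {0..dwell i} (traj i)"
    and trigger: "ereal (time i + dwell i) =
      min (ereal (time i + T)) (trigger_time f g k V a T \<theta> (est i) (time i) (pos i))"
    and traj_le: "t \<in> {0..dwell i} \<Longrightarrow> V (est i) (traj i t) \<le> V (est i) (pos i) + a (pos i)"
    and dwell_cases: "dwell i = T \<or> pos i \<noteq> 0 \<and> V (est i) (traj i (dwell i)) = V (est i) (pos i) + a (pos i)"
  using step[of i] unfolding event_step_def by auto

text \<open>The point \<open>\<theta>\<close> is its own projection, and projection onto a closed
  convex set is 1-Lipschitz.\<close>

lemma est_antimono: "dist (est (Suc i)) \<theta> \<le> dist (est i) \<theta>"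
  using closest_point_lipschitz[OF feasible(2,1), OF subspace_ker subspace_ker, of "Suc i" "est i" \<theta>]
    feasible(3)[OF subspace_ker[of "Suc i"]]
  by (metis closest_point_self empty_iff run_Suc(3))

text \<open>All estimates lie in one compact subset of \<open>\<Theta>\<close> determined by
  \<open>\<theta>\<close> and \<open>\<eta>\<^sub>0\<close>, so the quadratic bounds on
  \<open>V\<close> hold with constants independent of \<open>x\<^sub>0\<close>.\<close>

lemma est_ball: "est i \<in> \<Theta> \<inter> cball \<theta> (dist \<eta>\<^sub>0 \<theta>)"
proof -
  have "dist (est i) \<theta> \<le> dist \<eta>\<^sub>0 \<theta>"
    by (induction i) (use est_antimono order_trans in auto)
  then show ?thesis using est_in_Theta by (simp add: dist_commute)
qed

lemma step_dichotomy:
  obtains "est (Suc i) = est i" "dwell i = T" "dim (ker (Suc i)) = dim (ker i)"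
    "\<And>t. t \<in> {0..dwell i} \<Longrightarrow> V (est i) (traj i t) \<le> exp (- 2 * \<sigma> * t) * V (est i) (pos i)"
  | "dim (ker (Suc i)) < dim (ker i)"
proof (cases "ker (Suc i) = ker i")
  case False
  have "ker (Suc i) \<subseteq> ker i" unfolding run_Suc(4) by blast
  \<comment> \<open>Nested subspaces of equal dimension coincide.\<close>
  with False have "dim (ker (Suc i)) < dim (ker i)"
    using subspace_dim_equal[OF subspace_ker subspace_ker] by (metis not_less)
  then show thesis by (rule that(2))
next
  case True
  have "est (Suc i) = est i"
    unfolding run_Suc(3) True by (rule closest_point_self[OF est_feasible])
  \<comment> \<open>Membership in the old kernel concerns the past only; since the kernel did not
    change, \<open>g\<close> annihilates the estimation error along the present interval
    too.\<close>
  have "est i - \<theta> \<in> ker (Suc i)"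
    using est_minus_theta True by simp
  then have "g (traj i t) (k (est i) (traj i t)) *v est i = g (traj i t) (k (est i) (traj i t)) *v \<theta>"
    if "t \<in> {0..<dwell i}" for t
    using that unfolding run_Suc(4) by (auto simp: matrix_vector_mult_diff_distrib)
  then have cl: "closed_loop (est i) (traj i t) = plant f g (est i) (traj i t) (k (est i) (traj i t))"
    if "t \<in> {0..<dwell i}" for t
    using that by (simp add: plant_def)
  have decay: "V (est i) (traj i t) \<le> exp (- 2 * \<sigma> * t) * V (est i) (pos i)" if "t \<in> {0..dwell i}" for t
    using lyapunov_decay[OF V_C1[OF est_in_Theta] traj_ode[of i], where c = "2 * \<sigma>" and t = t] that
      V_decay[OF est_in_Theta, of i] cl traj_0[of i] by auto
  \<comment> \<open>Off the origin \<open>a\<close> is positive, so the trigger level lies strictly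
    above this value and the interval can only have ended by time-out.\<close>
  have "V (est i) (traj i (dwell i)) \<le> V (est i) (pos i)"
    using decay[of "dwell i"] dwell_pos[of i] sigma V_ge_0[OF est_in_Theta, of i "pos i"]
    by (smt (verit, best) atLeastAtMost_iff exp_le_one_iff mult_left_le_one_le mult_minus_left
        mult_nonneg_nonneg exp_ge_zero)
  then have "dwell i = T"
    using dwell_cases[of i] a_pos unfolding positive_definite_def by force
  with \<open>est (Suc i) = est i\<close> decay True show thesis by (intro that(1)) auto
qed

lemma dim_ker_le: "dim (ker i) \<le> CARD('l)"
  using dim_subset_UNIV_cart by blast

text \<open>A potential argument: an interval either has length \<open>T\<close> and keeps the
  dimension, or lowers the dimension by at least 1 and thereby pays for the increase of
  \<open>i\<close>.\<close>

lemma time_ge: "time i \<ge> T * (real i + real (dim (ker i)) - real CARD('l))"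
proof (induction i)
  case 0
  then show ?case by (simp add: dim_UNIV)
next
  case (Suc i)
  show ?case
  proof (rule step_dichotomy[of i])
    assume "dwell i = T" "dim (ker (Suc i)) = dim (ker i)"
    then show ?thesis using Suc by (simp add: run_Suc(1) algebra_simps)
  next
    assume "dim (ker (Suc i)) < dim (ker i)"
    then have "T * (real (Suc i) + real (dim (ker (Suc i))) - real CARD('l))
        \<le> T * (real i + real (dim (ker i)) - real CARD('l))"
      using T by (intro mult_left_mono) auto
    then show ?thesis using Suc dwell_pos[of i] by (simp add: run_Suc(1))
  qed
qed

lemma time_less_Suc: "time i < time (Suc i)"
  using dwell_pos[of i] by (simp add: run_Suc(1))

lemma strict_mono_time: "strict_mono time"
  by (simp add: strict_mono_Suc_iff time_less_Suc)

lemma time_unbounded: "\<exists>i. t < time i"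
proof -
  obtain i where "t / T + real CARD('l) < real i"
    using reals_Archimedean2 by blast
  then have "t < T * (real i - real CARD('l))"
    using T by (simp add: field_simps)
  also have "\<dots> \<le> T * (real i + real (dim (ker i)) - real CARD('l))"
    using T by (intro mult_left_mono) auto
  also have "\<dots> \<le> time i" by (rule time_ge)
  finally show ?thesis by blast
qed

section \<open>Gluing the intervals into a hybrid solution on the half line\<close>

definition "idx t = (LEAST i. t < time (Suc i))"

lemma idx_eq: "t \<in> {time i..<time (Suc i)} \<Longrightarrow> idx t = i"
  unfolding idx_def
proof (rule Least_equality)
  fix j assume t: "t \<in> {time i..<time (Suc i)}" and "t < time (Suc j)"
  then have "time i < time (Suc j)" by simp
  then show "i \<le> j" using strict_mono_less[OF strict_mono_time] by simp
qed simp

lemma idx: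
  assumes "t \<ge> 0"
  shows "t \<in> {time (idx t)..<time (Suc (idx t))}"
proof -
  obtain i where i: "t < time i" using time_unbounded by blast
  then have "t < time (Suc i)" using time_less_Suc[of i] by simp
  then have "t < time (Suc (idx t))"
    unfolding idx_def by (rule LeastI)
  moreover have "time (idx t) \<le> t"
  proof (cases "idx t")
    case (Suc j)
    then have "\<not> t < time (Suc j)"
      using not_less_Least[of j "\<lambda>i. t < time (Suc i)"] by (simp add: idx_def)
    then show ?thesis using Suc by simp
  qed (use assms in simp)
  ultimately show ?thesis by simp
qed

definition "state t = traj (idx t) (t - time (idx t))"
definition "param t = est (idx t)"

lemma solution_domain_time: "solution_domain time = {0..}"
proof -
  have "time i \<ge> 0" for i
    using strict_mono_less_eq[OF strict_mono_time, of 0 i] by simp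
  then show ?thesis
    unfolding solution_domain_def using idx by (fastforce intro: order_trans)
qed

lemma state_eq: "t \<in> {time i..<time (Suc i)} \<Longrightarrow> state t = traj i (t - time i)"
  by (simp only: state_def idx_eq)

lemma state_time: "state (time i) = pos i"
  using state_eq[of "time i" i] time_less_Suc[of i] by (simp add: traj_0)

text \<open>At the right end two pieces meet, and they agree because \<open>pos (Suc i)\<close> is
  the end of \<open>traj i\<close>. There is no analogue for \<open>param\<close>, which may
  jump.\<close>

lemma state_eq': "t \<in> {time i..time (Suc i)} \<Longrightarrow> state t = traj i (t - time i)"
  using state_eq[of t i] state_time[of "Suc i"]
  by (cases "t = time (Suc i)") (auto simp: run_Suc)

lemma param_eq: "t \<in> {time i..<time (Suc i)} \<Longrightarrow> param t = est i"
  by (simp only: param_def idx_eq)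

lemma param_time: "param (time i) = est i"
  using param_eq[of "time i" i] time_less_Suc[of i] by simp

lemma state_ode: "ode_solution (closed_loop (est i)) {time i..time (Suc i)} state"
proof (rule ode_solution_cong)
  show "ode_solution (closed_loop (est i)) {time i..time (Suc i)} (\<lambda>t. traj i (t - time i))"
    by (rule ode_solution_shift, rule ode_solution_subset[OF traj_ode]) (auto simp: run_Suc)
qed (use state_eq' in auto)

lemma continuous_on_state_Icc: "continuous_on {0..time i} state"
proof (induction i)
  case (Suc i)
  have "{0..time (Suc i)} = {0..time i} \<union> {time i..time (Suc i)}"
    using strict_mono_less_eq[OF strict_mono_time, of 0 i] time_less_Suc[of i] by auto
  then show ?case
    using continuous_on_closed_Un[OF _ _ Suc ode_solution_continuous_on[OF state_ode]] by simp
qed simp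

lemma continuous_on_state: "continuous_on {0..} state"
  unfolding continuous_on_eq_continuous_within
proof
  fix t :: real assume t: "t \<in> {0..}"
  obtain i where i: "t < time i" using time_unbounded by blast
  then have "continuous (at t within {0..time i}) state"
    using continuous_on_state_Icc t by (auto simp: continuous_on_eq_continuous_within)
  moreover have "at t within {0..time i} = at t within {0..}"
    by (rule at_within_nhd[of _ "{..<time i}"]) (use i in auto)
  ultimately show "continuous (at t within {0..}) state" by simp
qed

definition "input t = k (param t) (state t)"

text \<open>Passing from the local time of each interval to global time gives the form in which the
  kernel appears in \<open>least_squares_set_eq\<close>.\<close>

lemma ker_eq: "ker i = {v. \<forall>r\<in>{0..<time i}. g (state r) (input r) *v v = 0}"
proof (induction i)
  case (Suc i)
  have "{0..<time (Suc i)} = {0..<time i} \<union> {time i..<time (Suc i)}"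
    using strict_mono_less_eq[OF strict_mono_time, of 0 i] time_less_Suc[of i] by auto
  moreover have "(\<forall>r\<in>{0..<dwell i}. g (traj i r) (k (est i) (traj i r)) *v v = 0) \<longleftrightarrow>
      (\<forall>r\<in>{time i..<time (Suc i)}. g (state r) (input r) *v v = 0)" (is "?l \<longleftrightarrow> ?r") for v
  proof
    assume ?l
    then show ?r
      by (auto simp: input_def state_eq param_eq run_Suc(1))
  next
    assume r: ?r
    show ?l
    proof
      fix s assume "s \<in> {0..<dwell i}"
      then have "time i + s \<in> {time i..<time (Suc i)}" by (simp add: run_Suc(1))
      with r state_eq[OF this] param_eq[OF this]
      show "g (traj i s) (k (est i) (traj i s)) *v v = 0"
        by (metis (no_types) input_def add_diff_cancel_left')
    qed
  qed
  ultimately show ?case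
    unfolding run_Suc(4) Suc.IH by auto
qed simp

text \<open>These are the regularity hypotheses of \<open>least_squares_set_eq\<close>. On
  \<open>{time j..<time (Suc j)}\<close> the signal coincides with \<open>\<psi> j\<close>, whose
  estimate is frozen and which is continuous up to the right end; this gives the bounds and the
  right limits.\<close>

lemma piecewise_signal:
  fixes h :: "real^'n \<Rightarrow> real^'m \<Rightarrow> 'z::real_normed_vector"
  assumes h: "smooth_on (\<lambda>(x, u). h x u) UNIV"
  shows "continuous_on ({0..time i} - time ` {..i}) (\<lambda>r. h (state r) (input r))"
    and "bounded ((\<lambda>r. h (state r) (input r)) ` {0..time i})"
    and "r \<ge> 0 \<Longrightarrow> continuous (at_right r) (\<lambda>r. h (state r) (input r))"
proof -
  define \<phi> where "\<phi> r = h (state r) (input r)" for r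
  define \<psi> where "\<psi> j r = h (state r) (k (est j) (state r))" for j r
  have \<psi>: "continuous_on {time j..time (Suc j)} (\<psi> j)" for j
  proof -
    have c: "continuous_on {time j..time (Suc j)} state"
      by (rule ode_solution_continuous_on[OF state_ode])
    have "continuous_on {time j..time (Suc j)} (\<lambda>r. (state r, k (est j) (state r)))"
      by (rule continuous_on_Pair[OF c continuous_on_compose2[OF continuous_on_k[OF est_in_Theta] c subset_UNIV]])
    from continuous_on_compose2[OF smooth_on_UNIV_imp_continuous_on[OF h, of UNIV] this]
    show ?thesis by (simp add: \<psi>_def[abs_def])
  qed
  have \<phi>\<psi>: "\<phi> r = \<psi> j r" if "r \<in> {time j..<time (Suc j)}" for j r
    using param_eq[OF that] by (simp add: \<phi>_def \<psi>_def input_def)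
  have at: "isCont \<phi> r" if "r \<in> {time j<..<time (Suc j)}" for j r
  proof -
    have "continuous_on {time j<..<time (Suc j)} \<phi>"
      using continuous_on_subset[OF \<psi>[of j], of "{time j<..<time (Suc j)}"]
      by (rule continuous_on_eq) (use \<phi>\<psi>[of _ j] in auto)
    then show ?thesis
      using that by (simp add: continuous_on_eq_continuous_at)
  qed
  show "continuous_on ({0..time i} - time ` {..i}) (\<lambda>r. h (state r) (input r))"
  proof (rule continuous_at_imp_continuous_on, rule ballI)
    fix r assume r: "r \<in> {0..time i} - time ` {..i}"
    then have j: "r \<in> {time (idx r)..<time (Suc (idx r))}" using idx by auto
    then have "time (idx r) \<le> time i" using r by auto
    then have "idx r \<le> i" using strict_mono_less_eq[OF strict_mono_time] by blast
    then have "r \<noteq> time (idx r)" using r by auto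
    then show "isCont (\<lambda>r. h (state r) (input r)) r"
      using at[of r "idx r"] j by (auto simp: \<phi>_def[abs_def])
  qed
  show "continuous (at_right r) (\<lambda>r. h (state r) (input r))" if "r \<ge> 0"
  proof -
    have r: "r \<in> {time (idx r)..<time (Suc (idx r))}" using idx[OF that] .
    then have "continuous (at r within {r..time (Suc (idx r))}) (\<psi> (idx r))"
      using continuous_on_subset[OF \<psi>[of "idx r"], of "{r..time (Suc (idx r))}"]
      by (auto simp: continuous_on_eq_continuous_within)
    then have "continuous (at_right r) (\<psi> (idx r))"
      using r by (simp add: at_within_Icc_at_right)
    moreover have "\<forall>\<^sub>F s in at_right r. \<phi> s = \<psi> (idx r) s"
      using r \<phi>\<psi>[of _ "idx r"] by (auto simp: eventually_at_right_field intro!: exI[of _ "time (Suc (idx r))"])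
    ultimately have "continuous (at_right r) \<phi>"
      using \<phi>\<psi>[OF r] by (auto simp: continuous_within filterlim_cong[OF refl refl] dest: tendsto_cong)
    then show ?thesis by (simp add: \<phi>_def[abs_def])
  qed
  have "bounded (\<phi> ` {0..time i})"
  proof (induction i)
    case (Suc i)
    have sub: "{0..time (Suc i)} \<subseteq> {0..time i} \<union> {time i..<time (Suc i)} \<union> {time (Suc i)}"
      by auto
    have "bounded (\<psi> i ` {time i..time (Suc i)})"
      by (intro compact_imp_bounded compact_continuous_image \<psi>) simp
    moreover have "\<phi> ` {time i..<time (Suc i)} \<subseteq> \<psi> i ` {time i..time (Suc i)}"
      using \<phi>\<psi>[of _ i] by force
    ultimately have "bounded (\<phi> ` {time i..<time (Suc i)})"
      by (rule bounded_subset)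
    with Suc have "bounded (\<phi> ` ({0..time i} \<union> {time i..<time (Suc i)} \<union> {time (Suc i)}))"
      by (simp add: image_Un)
    then show ?case by (rule bounded_subset[OF _ image_mono[OF sub]])
  qed simp
  then show "bounded ((\<lambda>r. h (state r) (input r)) ` {0..time i})"
    by (simp add: \<phi>_def[abs_def])
qed

lemma least_squares_set_state: "least_squares_set \<Theta> f g state input (time (Suc i)) = feasible (ker (Suc i))"
proof -
  have "least_squares_set \<Theta> f g state input (time (Suc i)) =
    {\<eta>\<in>\<Theta>. \<forall>r\<in>{0..<time (Suc i)}. g (state r) (input r) *v (\<eta> - \<theta>) = 0}"
  proof (rule least_squares_set_eq)
    show "0 < time (Suc i)"
      using strict_mono_less[OF strict_mono_time, of 0 "Suc i"] by simp
    show "finite (time ` {..Suc i})" by simp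
    show "continuous_on {0..time (Suc i)} state"
      by (rule continuous_on_state_Icc)
    fix r assume r: "r \<in> {0<..<time (Suc i)} - time ` {..Suc i}"
    then have j: "r \<in> {time (idx r)..<time (Suc (idx r))}" using idx[of r] by simp
    then have "time (idx r) < time (Suc i)" using r by auto
    then have "idx r \<le> Suc i" using strict_mono_less[OF strict_mono_time] by (meson less_imp_le)
    then have "r \<noteq> time (idx r)" using r by auto
    then show "(state has_vector_derivative plant f g \<theta> (state r) (input r)) (at r)"
      using ode_solution_interior[OF state_ode, of "idx r" r] j param_eq[OF j] by (simp add: input_def)
  next
    show "continuous (at_right r) (\<lambda>r. g (state r) (input r))" if "r \<in> {0..<time (Suc i)}" for r
      using piecewise_signal(3)[OF g_smooth] that by simp
  qed (rule piecewise_signal[OF f_smooth] piecewise_signal[OF g_smooth])+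
  then show ?thesis
    unfolding feasible_def ker_eq by simp
qed

lemma hybrid_solution_state: "hybrid_solution \<Theta> f g k V a T \<theta> state param time"
  unfolding hybrid_solution_def
proof (intro conjI allI ballI)
  show "time 0 = 0" by simp
  show "time i < time (Suc i)" for i by (rule time_less_Suc)
  show "continuous_on (solution_domain time) state"
    unfolding solution_domain_time by (rule continuous_on_state)
  show "param t \<in> \<Theta>" for t unfolding param_def by (rule est_in_Theta)
  show "param t = param (time i)" if "t \<in> {time i..<time (Suc i)}" for i t
    using param_eq[OF that] param_time by simp
  show "ode_solution (\<lambda>z. plant f g \<theta> z (k (param (time i)) z)) {time i..<time (Suc i)} state" for i
    unfolding param_time by (rule ode_solution_subset[OF state_ode]) auto
  show "ereal (time (Suc i)) = min (ereal (time i + T))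
      (trigger_time f g k V a T \<theta> (param (time i)) (time i) (state (time i)))" for i
    unfolding param_time state_time using trigger[of i] by (simp add: run_Suc(1))
  fix i \<eta>
  define S where "S = feasible (ker (Suc i))"
  have S: "closed S" "convex S" "S \<noteq> {}"
    using feasible[OF subspace_ker[of "Suc i"]] by (auto simp: S_def)
  \<comment> \<open>Least change of the estimate means nearest point of a nonempty closed convex
    set, and convexity makes it the only minimizer.\<close>
  have "is_arg_min (\<lambda>\<zeta>. (norm (\<zeta> - est i))\<^sup>2) (\<lambda>\<zeta>. \<zeta> \<in> S) \<eta> \<longleftrightarrow>
      \<eta> \<in> S \<and> (\<forall>\<zeta>\<in>S. dist (est i) \<eta> \<le> dist (est i) \<zeta>)"
    by (auto simp: is_arg_min_linorder dist_norm norm_minus_commute abs_le_square_iff[symmetric])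
  also have "\<dots> \<longleftrightarrow> \<eta> = closest_point S (est i)"
    using closest_point_unique[OF S(2,1)] closest_point_in_set[OF S(1,3)] closest_point_le[OF S(1)]
    by metis
  finally show "is_arg_min (\<lambda>\<zeta>. (norm (\<zeta> - param (time i)))\<^sup>2)
      (\<lambda>\<zeta>. \<zeta> \<in> least_squares_set \<Theta> f g state (\<lambda>t. k (param t) (state t)) (time (Suc i))) \<eta>
      \<longleftrightarrow> \<eta> = param (time (Suc i))"
    unfolding param_time run_Suc(3) S_def[symmetric] input_def[symmetric]
      least_squares_set_state .
qed

text \<open>\<open>L\<close> is the price of an exceptional interval: \<open>K2 / K1\<close> for
  replacing the estimate inside \<open>V\<close>, \<open>1 + A / K1\<close> for the trigger level
  compared with the initial value of \<open>V\<close>, and \<open>exp (2 * \<sigma> * T)\<close> for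
  the missing decay. At most \<open>CARD('l)\<close> completed intervals are charged, and one more
  factor covers the interval containing \<open>t\<close>. The last \<open>K2 / K1\<close> passes
  from norms to \<open>V\<close> at time 0 and back at time \<open>t\<close>.\<close>

lemma exponential_estimate:
  assumes K1: "0 < K1" and K12: "K1 < K2"
    and V_lower: "\<And>\<eta> z. \<eta> \<in> \<Theta> \<inter> cball \<theta> (dist \<eta>\<^sub>0 \<theta>) \<Longrightarrow> K1 * (norm z)\<^sup>2 \<le> V \<eta> z"
    and V_upper: "\<And>\<eta> z. \<eta> \<in> \<Theta> \<inter> cball \<theta> (dist \<eta>\<^sub>0 \<theta>) \<Longrightarrow> V \<eta> z \<le> K2 * (norm z)\<^sup>2"
    and A: "A \<ge> 0" and a_le: "\<And>z. a z \<le> A * (norm z)\<^sup>2"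
    and t: "t \<ge> 0"
  defines "L \<equiv> K2 / K1 * ((1 + A / K1) * exp (2 * \<sigma> * T))"
  shows "norm (state t) \<le> sqrt (L ^ Suc CARD('l) * (K2 / K1)) * exp (- \<sigma> * t) * norm x\<^sub>0"
proof -
  define B where "B = (1 + A / K1) * exp (2 * \<sigma> * T)"
  have "1 \<le> 1 + A / K1" using A K1 by simp
  moreover have "1 \<le> exp (2 * \<sigma> * T)" using sigma T by simp
  ultimately have B1: "1 \<le> B"
    unfolding B_def using mult_mono[of 1 "1 + A / K1" 1 "exp (2 * \<sigma> * T)"] by simp
  have K: "1 \<le> K2 / K1" using K1 K12 by simp
  have L: "L = K2 / K1 * B" by (simp add: L_def B_def)
  have LB: "B \<le> L" using mult_right_mono[OF K, of B] B1 by (simp add: L)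
  have L1: "1 \<le> L" using LB B1 by simp
  have Vpos: "0 \<le> V (est i) z" for i z using V_ge_0[OF est_in_Theta] .
  have within: "V (est i) (traj i s) \<le> B * (exp (- 2 * \<sigma> * s) * V (est i) (pos i))"
    if s: "s \<in> {0..dwell i}" for i s
  proof -
    have "a (pos i) \<le> A * (V (est i) (pos i) / K1)"
    proof -
      have "(norm (pos i))\<^sup>2 \<le> V (est i) (pos i) / K1"
        using V_lower[OF est_ball, of "pos i" i] K1 by (simp add: field_simps)
      from mult_left_mono[OF this A] a_le[of "pos i"] show ?thesis by simp
    qed
    then have "V (est i) (traj i s) \<le> (1 + A / K1) * V (est i) (pos i)"
      using traj_le[OF s] by (simp add: algebra_simps)
    \<comment> \<open>The trigger level bounds growth but gives no decay; since
      \<open>s \<le> T\<close>, the decay factor can be inserted at the cost of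
      \<open>exp (2 * \<sigma> * T)\<close>.\<close>
    also have "\<dots> \<le> (1 + A / K1) * (exp (2 * \<sigma> * T) * exp (- 2 * \<sigma> * s) * V (est i) (pos i))"
    proof (intro mult_left_mono)
      have "1 \<le> exp (2 * \<sigma> * T) * exp (- 2 * \<sigma> * s)"
        using s dwell_le[of i] sigma by (simp add: exp_add[symmetric])
      from mult_right_mono[OF this Vpos] show "V (est i) (pos i) \<le> exp (2 * \<sigma> * T) * exp (- 2 * \<sigma> * s) * V (est i) (pos i)"
        by simp
    qed (use A K1 in simp)
    finally show ?thesis by (simp add: B_def mult_ac)
  qed
  \<comment> \<open>The exponent counts the dimensions lost so far, so it bounds the number of
    exceptional intervals before \<open>time i\<close>.\<close>
  have bound: "V (est i) (pos i) \<le> L ^ (CARD('l) - dim (ker i)) * (exp (- 2 * \<sigma> * time i) * (K2 * (norm x\<^sub>0)\<^sup>2))" for i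
  proof (induction i)
    case 0
    then show ?case using V_upper[OF est_ball, of 0 x\<^sub>0] by (simp add: dim_UNIV)
  next
    case (Suc i)
    define C where "C = CARD('l) - dim (ker i)"
    define E where "E = exp (- 2 * \<sigma> * dwell i)"
    define X where "X = K2 * (norm x\<^sub>0)\<^sup>2"
    have X: "X \<ge> 0" using K1 K12 by (simp add: X_def)
    have time: "exp (- 2 * \<sigma> * time (Suc i)) = E * exp (- 2 * \<sigma> * time i)"
      by (simp add: E_def run_Suc(1) exp_add[symmetric] algebra_simps)
    show ?case
    proof (rule step_dichotomy[of i])
      assume s: "est (Suc i) = est i" "dim (ker (Suc i)) = dim (ker i)"
        "\<And>t. t \<in> {0..dwell i} \<Longrightarrow> V (est i) (traj i t) \<le> exp (- 2 * \<sigma> * t) * V (est i) (pos i)"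
      have "V (est (Suc i)) (pos (Suc i)) \<le> E * V (est i) (pos i)"
        using s(3)[of "dwell i"] dwell_pos[of i] by (simp add: s(1) run_Suc(2) E_def)
      also have "\<dots> \<le> E * (L ^ C * (exp (- 2 * \<sigma> * time i) * X))"
        using Suc by (intro mult_left_mono) (auto simp: C_def X_def E_def)
      finally show ?thesis
        unfolding time X_def[symmetric] s(2) C_def[symmetric] by (simp add: mult_ac)
    next
      assume d: "dim (ker (Suc i)) < dim (ker i)"
      \<comment> \<open>The functions \<open>V (est (Suc i))\<close> and \<open>V (est i)\<close>
        are comparable only through the norm.\<close>
      have "V (est (Suc i)) (pos (Suc i)) \<le> K2 * (norm (pos (Suc i)))\<^sup>2"
        by (rule V_upper[OF est_ball])
      also have "\<dots> = K2 / K1 * (K1 * (norm (pos (Suc i)))\<^sup>2)"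
        using K1 by simp
      also have "\<dots> \<le> K2 / K1 * V (est i) (traj i (dwell i))"
        using K V_lower[OF est_ball] by (intro mult_left_mono) (auto simp: run_Suc(2))
      also have "\<dots> \<le> K2 / K1 * (B * (E * V (est i) (pos i)))"
        unfolding E_def using K dwell_pos[of i] by (intro mult_left_mono within) auto
      also have "\<dots> = L * E * V (est i) (pos i)"
        by (simp add: L mult_ac)
      also have "\<dots> \<le> L * E * (L ^ C * (exp (- 2 * \<sigma> * time i) * X))"
        using Suc L1 by (intro mult_left_mono) (auto simp: C_def X_def E_def)
      also have "\<dots> = L ^ Suc C * (E * exp (- 2 * \<sigma> * time i) * X)"
        by (simp add: mult_ac)
      \<comment> \<open>The dimension fell by at least 1, so the new exponent is at least
        \<open>Suc C\<close>; \<open>dim_ker_le\<close> guards the subtraction of natural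
        numbers.\<close>
      also have "\<dots> \<le> L ^ (CARD('l) - dim (ker (Suc i))) * (E * exp (- 2 * \<sigma> * time i) * X)"
        using d dim_ker_le[of i] L1 X
        by (intro mult_right_mono power_increasing) (auto simp: C_def E_def)
      finally show ?thesis
        unfolding time X_def[symmetric] by (simp add: mult_ac)
    qed
  qed
  define i where "i = idx t"
  define s where "s = t - time i"
  have s: "s \<in> {0..dwell i}"
    using idx[OF t] by (simp add: s_def i_def run_Suc(1))
  have st: "state t = traj i s" by (simp add: state_def s_def i_def)
  define X where "X = K2 * (norm x\<^sub>0)\<^sup>2"
  have X: "X \<ge> 0" using K1 K12 by (simp add: X_def)
  have "K1 * (norm (state t))\<^sup>2 \<le> V (est i) (traj i s)"
    unfolding st by (rule V_lower[OF est_ball])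
  also have "\<dots> \<le> B * (exp (- 2 * \<sigma> * s) * V (est i) (pos i))"
    by (rule within[OF s])
  \<comment> \<open>The current interval may be exceptional and unfinished, so it is charged one
    \<open>L\<close> in any case.\<close>
  also have "\<dots> \<le> L * (exp (- 2 * \<sigma> * s) * (L ^ CARD('l) * (exp (- 2 * \<sigma> * time i) * X)))"
  proof (intro mult_mono LB order_refl)
    have "V (est i) (pos i) \<le> L ^ (CARD('l) - dim (ker i)) * (exp (- 2 * \<sigma> * time i) * X)"
      using bound by (simp add: X_def)
    also have "\<dots> \<le> L ^ CARD('l) * (exp (- 2 * \<sigma> * time i) * X)"
      using L1 X by (intro mult_right_mono power_increasing) auto
    finally show "V (est i) (pos i) \<le> L ^ CARD('l) * (exp (- 2 * \<sigma> * time i) * X)" .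
  qed (use L1 Vpos in auto)
  also have "\<dots> = L ^ Suc CARD('l) * ((exp (- 2 * \<sigma> * s) * exp (- 2 * \<sigma> * time i)) * X)"
    by (simp add: mult_ac)
  also have "exp (- 2 * \<sigma> * s) * exp (- 2 * \<sigma> * time i) = (exp (- \<sigma> * t))\<^sup>2"
  proof -
    have "- 2 * \<sigma> * s + - 2 * \<sigma> * time i = 2 * (- \<sigma> * t)"
      by (simp add: s_def algebra_simps)
    then show ?thesis by (metis exp_add exp_double)
  qed
  also have "L ^ Suc CARD('l) * ((exp (- \<sigma> * t))\<^sup>2 * X) =
      K1 * (L ^ Suc CARD('l) * (K2 / K1) * (exp (- \<sigma> * t) * norm x\<^sub>0)\<^sup>2)"
    using K1 by (simp only: X_def power_mult_distrib) simp
  finally have "(norm (state t))\<^sup>2 \<le> L ^ Suc CARD('l) * (K2 / K1) * (exp (- \<sigma> * t) * norm x\<^sub>0)\<^sup>2"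
    using K1 by (rule mult_left_le_imp_le)
  then have "sqrt ((norm (state t))\<^sup>2) \<le> sqrt (L ^ Suc CARD('l) * (K2 / K1) * (exp (- \<sigma> * t) * norm x\<^sub>0)\<^sup>2)"
    by (rule real_sqrt_le_mono)
  then show ?thesis
    by (simp only: real_sqrt_mult real_sqrt_abs abs_norm_cancel abs_mult abs_exp_cancel mult.assoc)
qed

end

section \<open>Choice of the constants and assembly\<close>

theorem theorem4p3:
  fixes \<Theta> :: "(real^'l) set"
    and f :: "real^'n \<Rightarrow> real^'m \<Rightarrow> real^'n"
    and g :: "real^'n \<Rightarrow> real^'m \<Rightarrow> real^'l^'n"
    and k :: "real^'l \<Rightarrow> real^'n \<Rightarrow> real^'m"
    and V :: "real^'l \<Rightarrow> real^'n \<Rightarrow> real"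
    and a :: "real^'n \<Rightarrow> real"
    and \<sigma> T :: real
  assumes Theta: "closed \<Theta>" "convex \<Theta>"
    and f: "smooth_on (\<lambda>(x, u). f x u) UNIV" "f 0 0 = 0"
    and g: "smooth_on (\<lambda>(x, u). g x u) UNIV" "g 0 0 = 0"
    and k: "smooth_on (\<lambda>(\<theta>, x). k \<theta> x) (\<Theta> \<times> UNIV)" "\<And>\<theta>. \<theta> \<in> \<Theta> \<Longrightarrow> k \<theta> 0 = 0"
    and sigma: "\<sigma> > 0"
    and V_cont: "continuous_on (\<Theta> \<times> UNIV) (\<lambda>(\<theta>, x). V \<theta> x)"
    and V_nonneg: "\<And>\<theta> x. \<theta> \<in> \<Theta> \<Longrightarrow> V \<theta> x \<ge> 0"
    and V_C1: "\<And>\<theta>. \<theta> \<in> \<Theta> \<Longrightarrow> continuously_differentiable (V \<theta>)"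
    and V_pos: "\<And>\<theta>. \<theta> \<in> \<Theta> \<Longrightarrow> positive_definite (V \<theta>)"
    and V_rad: "\<And>\<theta>. \<theta> \<in> \<Theta> \<Longrightarrow> radially_unbounded (V \<theta>)"
    and H1_stable: "\<And>\<theta>. \<theta> \<in> \<Theta> \<Longrightarrow>
          globally_asymptotically_stable (\<lambda>x. plant f g \<theta> x (k \<theta> x))"
    and H1: "\<And>\<theta> x. \<theta> \<in> \<Theta> \<Longrightarrow>
          grad (V \<theta>) x \<bullet> plant f g \<theta> x (k \<theta> x) \<le> - 2 * \<sigma> * V \<theta> x"
    and H2: "\<And>\<Theta>' M. compact \<Theta>' \<Longrightarrow> \<Theta>' \<noteq> {} \<Longrightarrow> \<Theta>' \<subseteq> \<Theta> \<Longrightarrow> M \<ge> 0 \<Longrightarrow>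
          \<exists>R>0. \<forall>\<theta> x. V \<theta> x \<le> M \<and> \<theta> \<in> \<Theta>' \<longrightarrow> norm x \<le> R"
    and GES: "\<And>\<theta>. \<theta> \<in> \<Theta> \<Longrightarrow>
          globally_exponentially_stable (\<lambda>x. plant f g \<theta> x (k \<theta> x))"
    and V_quadratic: "\<And>\<Theta>'. compact \<Theta>' \<Longrightarrow> \<Theta>' \<noteq> {} \<Longrightarrow> \<Theta>' \<subseteq> \<Theta> \<Longrightarrow>
          \<exists>K\<^sub>1 K\<^sub>2. K\<^sub>2 > K\<^sub>1 \<and> K\<^sub>1 > 0 \<and>
            (\<forall>x. \<forall>\<theta>\<in>\<Theta>'. K\<^sub>1 * (norm x)\<^sup>2 \<le> V \<theta> x \<and> V \<theta> x \<le> K\<^sub>2 * (norm x)\<^sup>2)"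
    and T: "T > 0"
    and a_cont: "continuous_on UNIV a"
    and a_pos: "positive_definite a"
    and a_sup: "(SUP x\<in>{x. x \<noteq> 0}. ereal (a x / (norm x)\<^sup>2)) < \<infinity>"
  shows "\<exists>M :: real^'l \<Rightarrow> real^'l \<Rightarrow> real.
      (\<forall>\<theta>\<in>\<Theta>. \<forall>\<eta>\<in>\<Theta>. M \<theta> \<eta> > 0) \<and>
      (\<forall>\<theta>\<in>\<Theta>. \<forall>x\<^sub>0. \<forall>\<eta>\<^sub>0\<in>\<Theta>.
         \<exists>x h \<tau>. hybrid_solution \<Theta> f g k V a T \<theta> x h \<tau> \<and> x 0 = x\<^sub>0 \<and> h 0 = \<eta>\<^sub>0 \<and>
           (\<forall>x' h' \<tau>'. hybrid_solution \<Theta> f g k V a T \<theta> x' h' \<tau>' \<and> x' 0 = x\<^sub>0 \<and> h' 0 = \<eta>\<^sub>0 \<longrightarrow>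
              \<tau>' = \<tau> \<and> (\<forall>t\<in>solution_domain \<tau>. x' t = x t \<and> h' t = h t)) \<and>
           solution_domain \<tau> = {0..} \<and>
           (\<forall>t\<ge>0. norm (x t) \<le> M \<theta> \<eta>\<^sub>0 * exp (- \<sigma> * t) * norm x\<^sub>0))"
proof -
  \<comment> \<open>A real number above the finite supremum serves as quadratic bound off the
    origin, and at the origin both sides are 0.\<close>
  obtain A where A: "A \<ge> 0" and a_le: "a z \<le> A * (norm z)\<^sup>2" for z
  proof -
    obtain r where r: "(SUP x\<in>{x. x \<noteq> 0}. ereal (a x / (norm x)\<^sup>2)) < ereal r"
      using ereal_dense2[OF a_sup] by blast
    show thesis
    proof (rule that[of "max 0 r"])
      show "a z \<le> max 0 r * (norm z)\<^sup>2" for z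
      proof (cases "z = 0")
        case True
        then show ?thesis using a_pos by (simp add: positive_definite_def)
      next
        case False
        then have "ereal (a z / (norm z)\<^sup>2) \<le> (SUP x\<in>{x. x \<noteq> 0}. ereal (a x / (norm x)\<^sup>2))"
          by (intro SUP_upper) simp
        then have "ereal (a z / (norm z)\<^sup>2) < ereal r"
          using r by (rule le_less_trans)
        then have "a z / (norm z)\<^sup>2 \<le> max 0 r" by simp
        then show ?thesis using False by (simp add: pos_divide_le_eq)
      qed
    qed simp
  qed
  \<comment> \<open>The quantifier over \<open>x\<^sub>0\<close> is inside \<open>P\<close>, so
    choosing a witness \<open>M\<close> for each pair of parameters yields a family independent of
    the initial state.\<close>
  define P where "P \<theta> \<eta>\<^sub>0 M \<longleftrightarrow> M > 0 \<and> (\<forall>x\<^sub>0. \<exists>x h \<tau>. hybrid_solution \<Theta> f g k V a T \<theta> x h \<tau> \<and> x 0 = x\<^sub>0 \<and> h 0 = \<eta>\<^sub>0 \<and>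
           (\<forall>x' h' \<tau>'. hybrid_solution \<Theta> f g k V a T \<theta> x' h' \<tau>' \<and> x' 0 = x\<^sub>0 \<and> h' 0 = \<eta>\<^sub>0 \<longrightarrow>
              \<tau>' = \<tau> \<and> (\<forall>t\<in>solution_domain \<tau>. x' t = x t \<and> h' t = h t)) \<and>
           solution_domain \<tau> = {0..} \<and>
           (\<forall>t\<ge>0. norm (x t) \<le> M * exp (- \<sigma> * t) * norm x\<^sub>0))" for \<theta> \<eta>\<^sub>0 :: "real^'l" and M
  have "\<exists>M. P \<theta> \<eta>\<^sub>0 M" if theta: "\<theta> \<in> \<Theta>" and eta0: "\<eta>\<^sub>0 \<in> \<Theta>" for \<theta> \<eta>\<^sub>0
  proof -
    interpret adaptive_loop \<Theta> f g k V a \<sigma> T \<theta>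
      by unfold_locales (fact theta Theta f g k sigma V_C1 V_pos V_rad H1 T a_pos)+
    have "compact (\<Theta> \<inter> cball \<theta> (dist \<eta>\<^sub>0 \<theta>))" "\<Theta> \<inter> cball \<theta> (dist \<eta>\<^sub>0 \<theta>) \<noteq> {}"
      using Theta(1) theta by (auto intro: closed_Int_compact)
    from V_quadratic[OF this]
    obtain K1 K2 where K: "0 < K1" "K1 < K2"
      and Vl: "\<And>\<eta> z. \<eta> \<in> \<Theta> \<inter> cball \<theta> (dist \<eta>\<^sub>0 \<theta>) \<Longrightarrow> K1 * (norm z)\<^sup>2 \<le> V \<eta> z"
      and Vu: "\<And>\<eta> z. \<eta> \<in> \<Theta> \<inter> cball \<theta> (dist \<eta>\<^sub>0 \<theta>) \<Longrightarrow> V \<eta> z \<le> K2 * (norm z)\<^sup>2"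
      by blast
    define L where "L = K2 / K1 * ((1 + A / K1) * exp (2 * \<sigma> * T))"
    define M where "M = sqrt (L ^ Suc CARD('l) * (K2 / K1))"
    have "1 + A / K1 > 0" using A K by (simp add: add_pos_nonneg)
    then have "L > 0" using K by (simp add: L_def)
    then have M: "M > 0" using K by (simp add: M_def)
    have "P \<theta> \<eta>\<^sub>0 M"
      unfolding P_def
    proof (intro conjI allI M)
      \<comment> \<open>The initial state enters only now, when \<open>M\<close> is already
        determined by \<open>\<theta>\<close> and \<open>\<eta>\<^sub>0\<close>.\<close>
      fix x\<^sub>0
      interpret adaptive_run \<Theta> f g k V a \<sigma> T \<theta> x\<^sub>0 \<eta>\<^sub>0
        by unfold_locales (fact eta0)
      have init: "state 0 = x\<^sub>0" "param 0 = \<eta>\<^sub>0"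
        using state_time[of 0] param_time[of 0] by simp_all
      show "\<exists>x h \<tau>. hybrid_solution \<Theta> f g k V a T \<theta> x h \<tau> \<and> x 0 = x\<^sub>0 \<and> h 0 = \<eta>\<^sub>0 \<and>
           (\<forall>x' h' \<tau>'. hybrid_solution \<Theta> f g k V a T \<theta> x' h' \<tau>' \<and> x' 0 = x\<^sub>0 \<and> h' 0 = \<eta>\<^sub>0 \<longrightarrow>
              \<tau>' = \<tau> \<and> (\<forall>t\<in>solution_domain \<tau>. x' t = x t \<and> h' t = h t)) \<and>
           solution_domain \<tau> = {0..} \<and>
           (\<forall>t\<ge>0. norm (x t) \<le> M * exp (- \<sigma> * t) * norm x\<^sub>0)"
      proof (intro exI conjI allI impI ballI)
        show "hybrid_solution \<Theta> f g k V a T \<theta> state param time" by (rule hybrid_solution_state)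
        show "state 0 = x\<^sub>0" "param 0 = \<eta>\<^sub>0" by (fact init)+
        show "solution_domain time = {0..}" by (rule solution_domain_time)
        show "norm (state t) \<le> M * exp (- \<sigma> * t) * norm x\<^sub>0" if "t \<ge> 0" for t
          unfolding M_def L_def by (rule exponential_estimate[OF K Vl Vu A a_le that])
        fix x' h' \<tau>'
        assume *: "hybrid_solution \<Theta> f g k V a T \<theta> x' h' \<tau>' \<and> x' 0 = x\<^sub>0 \<and> h' 0 = \<eta>\<^sub>0"
        show "\<tau>' = time"
          using hybrid_solution_unique(1)[OF hybrid_solution_state] * init by auto
        fix t assume "t \<in> solution_domain time"
        then show "x' t = state t" "h' t = param t"
          using hybrid_solution_unique(2)[OF hybrid_solution_state] * init by auto
      qed
    qed
    then show ?thesis by blast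
  qed
  then obtain M where "P \<theta> \<eta>\<^sub>0 (M \<theta> \<eta>\<^sub>0)" if "\<theta> \<in> \<Theta>" "\<eta>\<^sub>0 \<in> \<Theta>" for \<theta> \<eta>\<^sub>0
    by metis
  then show ?thesis
    unfolding P_def by (intro exI[of _ M]) blast
qed

end
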